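(* Given a finite set of users $\mathcal U$, a finite set of items $\mathcal I$, a set of ratings $\mathcal R=(R_{ui})$ that users gave to items, and a set of user attributes $\mathcal A=\{A_1,\ldots,A_k\}$, the time-complexity of computing $N>0$ iterations of the basic reputation-based ranking scheme followed by the multi-attribute mitigation step (both defined in the context) is $\mathcal O\left(N|\mathcal U||\mathcal I|+k|\mathcal U|\right)$.
   Context: Time is measured in elementary operations: arithmetic operations on and comparisons of real numbers, and look-ups in tables, each have unit cost. The ratings are given as a table indexed by users and items, and the attribute classes as a table, indexed by users, listing the $k$ classes of each user; deciding to which tuple of classes a user belongs is done by reading these $k$ entries, at cost $\mathcal O(k)$ per user. Ratings: $\mathcal U$ and $\mathcal I$ are finite nonempty sets. $R_{ui}\in\,]0,1]$ if user $u$ rated item $i$, and $R_{ui}=0$ otherwise. $\mathcal U_i=\{u\in\mathcal U: R_{ui}>0\}$ and $\mathcal I_u=\{i\in\mathcal I:R_{ui}>0\}$; these are assumed nonempty for all $i$, $u$. Attributes: each attribute $A_j=\{a_{j,1},\ldots,a_{j,s_j}\}$ is a finite set of classes, and every user $u$ belongs to exactly one class $A_j(u)\in A_j$. For $l=(a_1,\ldots,a_k)\in A_1\times\cdots\times A_k$, $\mathcal U(l)=\{u\in\mathcal U: A_j(u)=a_j \text{ for } j=1,\ldots,k\}$. Notation: for a finite nonempty family of reals $v_1,\dots,v_n$, $\mathrm{avg}(v)=\frac1n\sum_{i} v_i$ and $\mathrm{std}(v)=\sqrt{\frac1n\sum_{i}(v_i-\mathrm{avg}(v))^2}$. Basic reputation-based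 ranking scheme: fix $\lambda\in\,]0,1[$ and initial reputations $c_u^0\in\,]0,1]$ (the choice $c_u^0=1$ is used). For $t=0,\ldots,N-1$, $$r_i^{t+1}=\frac{\sum_{u\in\mathcal U_i}R_{ui}c_u^t}{\sum_{u\in\mathcal U_i}c_u^t}\ (i\in\mathcal I),\qquad c_u^{t+1}=1-\frac{\lambda}{|\mathcal I_u|}\sum_{i\in\mathcal I_u}|R_{ui}-r_i^{t+1}|\ (u\in\mathcal U).$$ Multi-attribute mitigation step: for each $l\in A_1\times\cdots\times A_k$ with $\mathcal U(l)\ne\emptyset$, let $\mu_l=\mathrm{avg}(\{c_u^N\}_{u\in\mathcal U(l)})$ and $\sigma_l=\mathrm{std}(\{c_u^N\}_{u\in\mathcal U(l)})$ (assumed $>0$), and let $\mu=\min_l\mu_l$, $\sigma=\min_l\sigma_l$, the minima being over all such $l$. The outputs are $$c_u=\mu+(c_u^N-\mu_l)\frac{\sigma}{\sigma_l}\quad\text{for } u\in\mathcal U(l),\qquad r_i=\frac{\sum_{u\in\mathcal U_i}R_{ui}c_u}{\sum_{u\in\mathcal U_i}c_u}\quad (i\in\mathcal I).$$ *)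

theory Defs
  imports Complex_Main "HOL-Library.FuncSet"
begin

section \<open>Ratings, attributes and the two computation steps\<close>

record ('u, 'i, 'a) rating_data =
  users :: "'u set"
  items :: "'i set"
  rating :: "'u \<Rightarrow> 'i \<Rightarrow> real"
  num_attrs :: nat
  attr_classes :: "nat \<Rightarrow> 'a set"
  class_of :: "nat \<Rightarrow> 'u \<Rightarrow> 'a"
  lam :: real
  init_rep :: "'u \<Rightarrow> real"

definition raters :: "('u, 'i, 'a) rating_data \<Rightarrow> 'i \<Rightarrow> 'u set" where
  "raters D i = {u \<in> users D. rating D u i > 0}"

definition rated :: "('u, 'i, 'a) rating_data \<Rightarrow> 'u \<Rightarrow> 'i set" where
  "rated D u = {i \<in> items D. rating D u i > 0}"

definition wf_data :: "('u, 'i, 'a) rating_data \<Rightarrow> bool" where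
  "wf_data D \<longleftrightarrow>
     finite (users D) \<and> users D \<noteq> {} \<and> finite (items D) \<and> items D \<noteq> {} \<and>
     (\<forall>u\<in>users D. \<forall>i\<in>items D. rating D u i = 0 \<or> rating D u i \<in> {0<..1}) \<and>
     (\<forall>i\<in>items D. raters D i \<noteq> {}) \<and> (\<forall>u\<in>users D. rated D u \<noteq> {}) \<and>
     (\<forall>j\<in>{1..num_attrs D}. finite (attr_classes D j) \<and>
        (\<forall>u\<in>users D. class_of D j u \<in> attr_classes D j)) \<and>
     lam D \<in> {0<..<1} \<and> (\<forall>u\<in>users D. init_rep D u \<in> {0<..1})"

definition ranking :: "('u, 'i, 'a) rating_data \<Rightarrow> ('u \<Rightarrow> real) \<Rightarrow> 'i \<Rightarrow> real" where
  "ranking D c i = (\<Sum>u\<in>raters D i. rating D u i * c u) / (\<Sum>u\<in>raters D i. c u)"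

text \<open>\<open>reputation D t\<close> is $c^t$, and \<open>ranking D (reputation D t)\<close> is $r^{t+1}$.\<close>

primrec reputation :: "('u, 'i, 'a) rating_data \<Rightarrow> nat \<Rightarrow> 'u \<Rightarrow> real" where
  "reputation D 0 = init_rep D"
| "reputation D (Suc t) = (\<lambda>u. 1 - lam D / real (card (rated D u)) *
     (\<Sum>i\<in>rated D u. \<bar>rating D u i - ranking D (reputation D t) i\<bar>))"

definition avg :: "('u \<Rightarrow> real) \<Rightarrow> 'u set \<Rightarrow> real" where
  "avg v X = (\<Sum>x\<in>X. v x) / real (card X)"

definition std :: "('u \<Rightarrow> real) \<Rightarrow> 'u set \<Rightarrow> real" where
  "std v X = sqrt ((\<Sum>x\<in>X. (v x - avg v X)\<^sup>2) / real (card X))"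

definition users_in :: "('u, 'i, 'a) rating_data \<Rightarrow> (nat \<Rightarrow> 'a) \<Rightarrow> 'u set" where
  "users_in D l = {u \<in> users D. \<forall>j\<in>{1..num_attrs D}. class_of D j u = l j}"

definition occurring_tuples :: "('u, 'i, 'a) rating_data \<Rightarrow> (nat \<Rightarrow> 'a) set" where
  "occurring_tuples D = {l \<in> Pi\<^sub>E {1..num_attrs D} (attr_classes D). users_in D l \<noteq> {}}"

definition tuple_of :: "('u, 'i, 'a) rating_data \<Rightarrow> 'u \<Rightarrow> nat \<Rightarrow> 'a" where
  "tuple_of D u = (\<lambda>j\<in>{1..num_attrs D}. class_of D j u)"

lemma users_in_iff_tuple_of:
  assumes "l \<in> Pi\<^sub>E {1..num_attrs D} (attr_classes D)" and "u \<in> users D"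
  shows "u \<in> users_in D l \<longleftrightarrow> l = tuple_of D u"
proof
  assume "u \<in> users_in D l"
  then show "l = tuple_of D u"
    using PiE_arb[OF assms(1)] by (intro ext) (simp add: users_in_def tuple_of_def restrict_def)
next
  assume "l = tuple_of D u"
  then show "u \<in> users_in D l"
    using assms(2) by (simp add: users_in_def tuple_of_def)
qed

definition group_avg :: "('u, 'i, 'a) rating_data \<Rightarrow> nat \<Rightarrow> (nat \<Rightarrow> 'a) \<Rightarrow> real" where
  "group_avg D N l = avg (reputation D N) (users_in D l)"

definition group_std :: "('u, 'i, 'a) rating_data \<Rightarrow> nat \<Rightarrow> (nat \<Rightarrow> 'a) \<Rightarrow> real" where
  "group_std D N l = std (reputation D N) (users_in D l)"

definition mitigated_reputation :: "('u, 'i, 'a) rating_data \<Rightarrow> nat \<Rightarrow> 'u \<Rightarrow> real" where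
  "mitigated_reputation D N u =
     (let l = tuple_of D u;
          \<mu> = Min (group_avg D N ` occurring_tuples D);
          \<sigma> = Min (group_std D N ` occurring_tuples D)
      in \<mu> + (reputation D N u - group_avg D N l) * (\<sigma> / group_std D N l))"

definition mitigated_ranking :: "('u, 'i, 'a) rating_data \<Rightarrow> nat \<Rightarrow> 'i \<Rightarrow> real" where
  "mitigated_ranking D N = ranking D (mitigated_reputation D N)"


section \<open>Programs with unit-cost real arithmetic and tables\<close>

text \<open>
  A while language over two kinds of tables: tables of reals, and tables of natural
  numbers used for indices, counters and class numbers. A scalar variable is a table with
  the empty index list. A program is a fixed piece of syntax, so it contains only finitely
  many constants and the number of indices of each access is fixed. There is no
  conversion from reals to naturals (no rounding), the only arithmetic on
  naturals is addition, and only integer constants can be used as reals. The square root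
  counts as an arithmetic operation, being needed for the standard deviation.
  Division is that of HOL (so \<open>x / 0 = 0\<close>), both here and in the mathematical definitions
  above. For well-formed data with positive group deviations, the only mathematical
  denominator that can vanish is that of the final ranking, since
  mitigated reputations need not be positive.
\<close>

type_synonym vname = string

record state =
  ntab :: "vname \<Rightarrow> nat list \<Rightarrow> nat"
  rtab :: "vname \<Rightarrow> nat list \<Rightarrow> real"

datatype nexp = NConst nat | NGet vname "nexp list" | NAdd nexp nexp

datatype rexp = RConst int | RGet vname "nexp list"
  | RAdd rexp rexp | RSub rexp rexp | RMul rexp rexp | RDiv rexp rexp | RSqrt rexp

datatype bexp = NLess nexp nexp | NEq nexp nexp | RLess rexp rexp | REq rexp rexp
  | BNot bexp | BAnd bexp bexp

datatype com = Skip
  | NSet vname "nexp list" nexp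
  | RSet vname "nexp list" rexp
  | Seq com com
  | Cond bexp com com
  | While bexp com

fun nval :: "state \<Rightarrow> nexp \<Rightarrow> nat" where
  "nval s (NConst n) = n"
| "nval s (NGet x es) = ntab s x (map (nval s) es)"
| "nval s (NAdd a b) = nval s a + nval s b"

fun rval :: "state \<Rightarrow> rexp \<Rightarrow> real" where
  "rval s (RConst z) = of_int z"
| "rval s (RGet x es) = rtab s x (map (nval s) es)"
| "rval s (RAdd a b) = rval s a + rval s b"
| "rval s (RSub a b) = rval s a - rval s b"
| "rval s (RMul a b) = rval s a * rval s b"
| "rval s (RDiv a b) = rval s a / rval s b"
| "rval s (RSqrt a) = sqrt (rval s a)"

fun bval :: "state \<Rightarrow> bexp \<Rightarrow> bool" where
  "bval s (NLess a b) \<longleftrightarrow> nval s a < nval s b"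
| "bval s (NEq a b) \<longleftrightarrow> nval s a = nval s b"
| "bval s (RLess a b) \<longleftrightarrow> rval s a < rval s b"
| "bval s (REq a b) \<longleftrightarrow> rval s a = rval s b"
| "bval s (BNot b) \<longleftrightarrow> \<not> bval s b"
| "bval s (BAnd b c) \<longleftrightarrow> bval s b \<and> bval s c"

text \<open>Every operation, comparison, constant and table access costs one unit.\<close>

fun ncost :: "nexp \<Rightarrow> nat" where
  "ncost (NConst n) = 1"
| "ncost (NGet x es) = 1 + sum_list (map ncost es)"
| "ncost (NAdd a b) = 1 + ncost a + ncost b"

fun rcost :: "rexp \<Rightarrow> nat" where
  "rcost (RConst z) = 1"
| "rcost (RGet x es) = 1 + sum_list (map ncost es)"
| "rcost (RAdd a b) = 1 + rcost a + rcost b"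
| "rcost (RSub a b) = 1 + rcost a + rcost b"
| "rcost (RMul a b) = 1 + rcost a + rcost b"
| "rcost (RDiv a b) = 1 + rcost a + rcost b"
| "rcost (RSqrt a) = 1 + rcost a"

fun bcost :: "bexp \<Rightarrow> nat" where
  "bcost (NLess a b) = 1 + ncost a + ncost b"
| "bcost (NEq a b) = 1 + ncost a + ncost b"
| "bcost (RLess a b) = 1 + rcost a + rcost b"
| "bcost (REq a b) = 1 + rcost a + rcost b"
| "bcost (BNot b) = 1 + bcost b"
| "bcost (BAnd b c) = 1 + bcost b + bcost c"

definition nupd :: "state \<Rightarrow> vname \<Rightarrow> nat list \<Rightarrow> nat \<Rightarrow> state" where
  "nupd s x is v = s\<lparr>ntab := (ntab s)(x := (ntab s x)(is := v))\<rparr>"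

definition rupd :: "state \<Rightarrow> vname \<Rightarrow> nat list \<Rightarrow> real \<Rightarrow> state" where
  "rupd s x is v = s\<lparr>rtab := (rtab s)(x := (rtab s x)(is := v))\<rparr>"

text \<open>\<open>run P s n t\<close>: started in \<open>s\<close>, \<open>P\<close> terminates in \<open>t\<close> at total cost \<open>n\<close>.\<close>

inductive run :: "com \<Rightarrow> state \<Rightarrow> nat \<Rightarrow> state \<Rightarrow> bool" where
  Skip: "run Skip s 1 s"
| NSet: "run (NSet x es e) s (1 + sum_list (map ncost es) + ncost e)
           (nupd s x (map (nval s) es) (nval s e))"
| RSet: "run (RSet x es e) s (1 + sum_list (map ncost es) + rcost e)
           (rupd s x (map (nval s) es) (rval s e))"
| Seq: "run P s m s' \<Longrightarrow> run Q s' n t \<Longrightarrow> run (Seq P Q) s (m + n) t"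
| CondTrue: "bval s b \<Longrightarrow> run P s n t \<Longrightarrow> run (Cond b P Q) s (bcost b + n) t"
| CondFalse: "\<not> bval s b \<Longrightarrow> run Q s n t \<Longrightarrow> run (Cond b P Q) s (bcost b + n) t"
| WhileFalse: "\<not> bval s b \<Longrightarrow> run (While b P) s (bcost b) s"
| WhileTrue: "bval s b \<Longrightarrow> run P s m s' \<Longrightarrow> run (While b P) s' n t \<Longrightarrow>
    run (While b P) s (bcost b + m + n) t"

lemma run_deterministic: "run P s n t \<Longrightarrow> run P s n' t' \<Longrightarrow> n' = n \<and> t' = t"
proof (induction arbitrary: n' t' rule: run.induct)
  case (Skip s)
  from Skip.prems show ?case by cases simp
next
  case (NSet x es e s)
  from NSet.prems show ?case by cases simp
next
  case (RSet x es e s)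
  from RSet.prems show ?case by cases simp
next
  case (Seq P s m s' Q n t)
  from Seq.prems obtain m1 s1 n1
    where "n' = m1 + n1" "run P s m1 s1" "run Q s1 n1 t'"
    by cases
  with Seq.IH show ?case by blast
next
  case (CondTrue s b P n t Q)
  from CondTrue.prems obtain n1
    where "n' = bcost b + n1" "run P s n1 t'"
    using CondTrue.hyps(1) by cases simp_all
  with CondTrue.IH show ?case by blast
next
  case (CondFalse s b Q n t P)
  from CondFalse.prems obtain n1
    where "n' = bcost b + n1" "run Q s n1 t'"
    using CondFalse.hyps(1) by cases simp_all
  with CondFalse.IH show ?case by blast
next
  case (WhileFalse s b P)
  from WhileFalse.prems show ?case using WhileFalse.hyps by cases simp_all
next
  case (WhileTrue s b P m s' n t)
  from WhileTrue.prems obtain m1 s1 n1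
    where "n' = bcost b + m1 + n1" "run P s m1 s1" "run (While b P) s1 n1 t'"
    using WhileTrue.hyps(1) by cases simp_all
  with WhileTrue.IH show ?case by blast
qed


section \<open>Input and output conventions\<close>

text \<open>
  Users, items and the classes of each attribute are addressed by arbitrary
  numberings \<open>\<nu>\<close>, \<open>\<iota>\<close>, \<open>\<kappa>\<close>.
\<close>

definition numbering ::
  "('u, 'i, 'a) rating_data \<Rightarrow> ('u \<Rightarrow> nat) \<Rightarrow> ('i \<Rightarrow> nat) \<Rightarrow> (nat \<Rightarrow> 'a \<Rightarrow> nat) \<Rightarrow> bool" where
  "numbering D \<nu> \<iota> \<kappa> \<longleftrightarrow>
     bij_betw \<nu> (users D) {..<card (users D)} \<and>
     bij_betw \<iota> (items D) {..<card (items D)} \<and>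
     (\<forall>j\<in>{1..num_attrs D}. bij_betw (\<kappa> j) (attr_classes D j) {..<card (attr_classes D j)})"

text \<open>All tables other than the input tables are initially zero.\<close>

definition input_state ::
  "('u, 'i, 'a) rating_data \<Rightarrow> nat \<Rightarrow> ('u \<Rightarrow> nat) \<Rightarrow> ('i \<Rightarrow> nat) \<Rightarrow> (nat \<Rightarrow> 'a \<Rightarrow> nat)
    \<Rightarrow> state \<Rightarrow> bool" where
  "input_state D N \<nu> \<iota> \<kappa> s \<longleftrightarrow>
     ntab s ''U'' [] = card (users D) \<and> ntab s ''I'' [] = card (items D) \<and>
     ntab s ''k'' [] = num_attrs D \<and> ntab s ''N'' [] = N \<and>
     (\<forall>u\<in>users D. \<forall>j\<in>{1..num_attrs D}. ntab s ''A'' [\<nu> u, j] = \<kappa> j (class_of D j u)) \<and>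
     rtab s ''lambda'' [] = lam D \<and>
     (\<forall>u\<in>users D. \<forall>i\<in>items D. rtab s ''R'' [\<nu> u, \<iota> i] = rating D u i) \<and>
     (\<forall>u\<in>users D. rtab s ''c0'' [\<nu> u] = init_rep D u) \<and>
     (\<forall>x is. x \<notin> {''U'', ''I'', ''k'', ''N'', ''A''} \<longrightarrow> ntab s x is = 0) \<and>
     (\<forall>x is. x \<notin> {''lambda'', ''R'', ''c0''} \<longrightarrow> rtab s x is = 0)"

definition output_state ::
  "('u, 'i, 'a) rating_data \<Rightarrow> nat \<Rightarrow> ('u \<Rightarrow> nat) \<Rightarrow> ('i \<Rightarrow> nat) \<Rightarrow> state \<Rightarrow> bool" where
  "output_state D N \<nu> \<iota> t \<longleftrightarrow>
     (\<forall>u\<in>users D. rtab t ''c'' [\<nu> u] = mitigated_reputation D N u) \<and>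
     (\<forall>i\<in>items D. rtab t ''r'' [\<iota> i] = mitigated_ranking D N i)"

end

theory Submission
  imports Defs
begin

text \<open>
  An iteration visits every user-item pair a bounded number of times. The point of the mitigation
  step is to avoid the exponentially many class tuples: only those that occur matter, and these
  are found by refining the partition of the users one attribute at a time, each refinement
  costing one pass over the users. Sums over a group are then accumulated in a table indexed by
  the number of the group, and the minima over the occurring tuples are minima over the users.
\<close>

section \<open>Cost-bounded total correctness\<close>

text \<open>A class tuple has as many entries as there are attributes, whereas each table access in
  a fixed program has a fixed number of indices, so no table can be indexed by class tuples
  directly. One number per user that stands for all classes read so far removes this obstacle: three
  indices (attribute, current number, next class) suffice to find the next number. The numbers are
  canonical, hence functions of the input, and the invariants need no existentially chosen naming of
  the groups. Clearing a table between attributes would cost too much. Each attribute therefore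
  works in a layer of its own, which is still zero from the start. Naturals cannot be converted to
  reals, so cardinalities are accumulated as real sums of ones. Group averages and deviations are
  copied to the users, so that no loop ever has to enumerate groups. Branches differ in cost, so the
  reasoning carries upper bounds with explicit numerals. Lower-order terms are absorbed only at the
  very end, where the factors that are at least 1 are known.\<close>

definition exec :: "com \<Rightarrow> state \<Rightarrow> nat \<Rightarrow> (state \<Rightarrow> bool) \<Rightarrow> bool" where
  "exec P s k Q \<longleftrightarrow> (\<exists>n t. run P s n t \<and> n \<le> k \<and> Q t)"

primrec writes :: "com \<Rightarrow> vname set" where
  "writes Skip = {}"
| "writes (NSet x es e) = {x}"
| "writes (RSet x es e) = {x}"
| "writes (Seq P Q) = writes P \<union> writes Q"
| "writes (Cond b P Q) = writes P \<union> writes Q"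
| "writes (While b P) = writes P"

text \<open>The set lists names without the kind of table: a name in \<open>W\<close> leaves both
  the natural and the real table of that name free to change.\<close>

definition agree :: "vname set \<Rightarrow> state \<Rightarrow> state \<Rightarrow> bool" where
  "agree W s t \<longleftrightarrow> (\<forall>y. y \<notin> W \<longrightarrow> ntab t y = ntab s y \<and> rtab t y = rtab s y)"

lemma agree_refl: "agree W s s"
  by (simp add: agree_def)

lemma agree_trans: "agree V s t \<Longrightarrow> agree W t t' \<Longrightarrow> V \<union> W \<subseteq> X \<Longrightarrow> agree X s t'"
  unfolding agree_def by (metis UnCI subsetD)

lemma agree_ntab: "agree W s t \<Longrightarrow> y \<notin> W \<Longrightarrow> ntab t y = ntab s y"
  by (simp add: agree_def)

lemma agree_rtab: "agree W s t \<Longrightarrow> y \<notin> W \<Longrightarrow> rtab t y = rtab s y"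
  by (simp add: agree_def)

lemma ntab_nupd [simp]:
  "ntab (nupd s x is v) y = (if y = x then (ntab s x)(is := v) else ntab s y)"
  by (simp add: nupd_def)

lemma rtab_nupd [simp]: "rtab (nupd s x is v) = rtab s"
  by (simp add: nupd_def)

lemma rtab_rupd [simp]:
  "rtab (rupd s x is v) y = (if y = x then (rtab s x)(is := v) else rtab s y)"
  by (simp add: rupd_def)

lemma ntab_rupd [simp]: "ntab (rupd s x is v) = ntab s"
  by (simp add: rupd_def)

lemma agree_nupd: "x \<in> W \<Longrightarrow> agree W s (nupd s x is v)"
  by (auto simp: agree_def)

text \<open>Frame property: \<open>writes\<close> is computed from the syntax alone, so what a
  program leaves unchanged never has to be stated in a postcondition.\<close>

lemma run_agree: "run P s n t \<Longrightarrow> agree (writes P) s t"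
  by (induction rule: run.induct) (auto simp: agree_def)

lemma exec_Skip: "Q s \<Longrightarrow> 1 \<le> k \<Longrightarrow> exec Skip s k Q"
  unfolding exec_def using run.Skip by blast

lemma exec_NSet:
  "Q (nupd s x (map (nval s) es) (nval s e)) \<Longrightarrow>
   1 + sum_list (map ncost es) + ncost e \<le> k \<Longrightarrow> exec (NSet x es e) s k Q"
  unfolding exec_def using run.NSet by blast

lemma exec_RSet:
  "Q (rupd s x (map (nval s) es) (rval s e)) \<Longrightarrow>
   1 + sum_list (map ncost es) + rcost e \<le> k \<Longrightarrow> exec (RSet x es e) s k Q"
  unfolding exec_def using run.RSet by blast

lemma exec_Cond:
  assumes "bval s b \<Longrightarrow> exec P s k Q" and "\<not> bval s b \<Longrightarrow> exec P' s k Q" and "bcost b + k \<le> k'"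
  shows "exec (Cond b P P') s k' Q"
proof (cases "bval s b")
  case True
  with assms(1) obtain n t where "run P s n t" "n \<le> k" "Q t"
    unfolding exec_def by blast
  with True assms(3) show ?thesis
    unfolding exec_def by (meson add_left_mono le_trans run.CondTrue)
next
  case False
  with assms(2) obtain n t where "run P' s n t" "n \<le> k" "Q t"
    unfolding exec_def by blast
  with False assms(3) show ?thesis
    unfolding exec_def by (meson add_left_mono le_trans run.CondFalse)
qed

text \<open>The frame of the first program is handed to the second for free, so \<open>R\<close>
  only has to record what the first program newly establishes.\<close>

lemma exec_Seq:
  assumes "exec P s k1 R" and "\<And>t. R t \<Longrightarrow> agree (writes P) s t \<Longrightarrow> exec P' t k2 Q" and "k1 + k2 \<le> k"
  shows "exec (Seq P P') s k Q"
proof -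
  obtain n t where "run P s n t" "n \<le> k1" "R t"
    using assms(1) unfolding exec_def by blast
  moreover from this obtain n' t' where "run P' t n' t'" "n' \<le> k2" "Q t'"
    using assms(2) run_agree unfolding exec_def by blast
  moreover have "n + n' \<le> k"
    using \<open>n \<le> k1\<close> \<open>n' \<le> k2\<close> assms(3) by linarith
  ultimately show ?thesis
    unfolding exec_def by (meson run.Seq)
qed

lemma exec_conseq:
  assumes "exec P s k Q" and "\<And>t. Q t \<Longrightarrow> agree (writes P) s t \<Longrightarrow> R t" and "k \<le> k'"
  shows "exec P s k' R"
  using assms run_agree unfolding exec_def by (meson le_trans)

section \<open>Counted loops\<close>

definition Get :: "vname \<Rightarrow> nexp" where
  "Get x = NGet x []"

lemma nval_Get [simp]: "nval s (Get x) = ntab s x []"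
  and ncost_Get [simp]: "ncost (Get x) = 1"
  by (simp_all add: Get_def)

definition For :: "vname \<Rightarrow> vname \<Rightarrow> com \<Rightarrow> com" where
  "For x b P = Seq (NSet x [] (NConst 0))
     (While (NLess (Get x) (Get b)) (Seq P (NSet x [] (NAdd (Get x) (NConst 1)))))"

lemma writes_For [simp]: "writes (For x b P) = insert x (writes P)"
  by (auto simp: For_def)

text \<open>Since neither counter nor bound is written by the body, there are exactly
  \<open>n\<close> rounds. A round costs the body plus 3 for the test and 4 for the increment; the
  remaining 5 are 2 for the initialisation and 3 for the last, failing test. The increment follows
  the body, so the invariant for \<open>Suc j\<close> is required only after the counter has been
  updated.\<close>

lemma exec_For:
  assumes x: "x \<notin> writes P" and b: "b \<notin> insert x (writes P)" and n: "ntab s b [] = n"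
    and init: "Inv 0 (nupd s x [] 0)"
    and step: "\<And>j t. j < n \<Longrightarrow> Inv j t \<Longrightarrow> ntab t x [] = j \<Longrightarrow> agree (insert x (writes P)) s t \<Longrightarrow>
      exec P t K (\<lambda>t'. Inv (Suc j) (nupd t' x [] (Suc j)))"
    and k: "n * (K + 7) + 5 \<le> k"
  shows "exec (For x b P) s k (Inv n)"
proof -
  let ?body = "Seq P (NSet x [] (NAdd (Get x) (NConst 1)))"
  let ?W = "While (NLess (Get x) (Get b)) ?body"
  \<comment> \<open>Generalised to a loop entered with counter \<open>j\<close>, so that the
    induction can go down from \<open>n\<close>, where the test fails.\<close>
  have loop: "exec ?W t ((n - j) * (K + 7) + 3) (Inv n)"
    if "j \<le> n" "Inv j t" "ntab t x [] = j" "agree (insert x (writes P)) s t" for j t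
    using that
  proof (induction j arbitrary: t rule: inc_induct)
    case base
    have "\<not> bval t (NLess (Get x) (Get b))"
      using base agree_ntab[OF base(3) b] n by simp
    then have "run ?W t 3 t"
      using run.WhileFalse[of t "NLess (Get x) (Get b)" ?body] by (simp add: numeral_3_eq_3)
    then show ?case
      unfolding exec_def using base by (intro exI[of _ 3] exI[of _ t]) simp
  next
    case (step j)
    have "bval t (NLess (Get x) (Get b))"
      using step agree_ntab[OF step.prems(3) b] n by simp
    moreover obtain m t' where t': "run P t m t'" "m \<le> K" "Inv (Suc j) (nupd t' x [] (Suc j))"
      using assms(5)[OF step.hyps(2) step.prems] unfolding exec_def by blast
    have agr: "agree (writes P) t t'"
      using run_agree[OF t'(1)] .
    have x': "ntab t' x [] = j"
      using agree_ntab[OF agr x] step.prems(2) by simp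
    define t2 where "t2 = nupd t' x [] (Suc j)"
    have "run (NSet x [] (NAdd (Get x) (NConst 1))) t' 4 t2"
      using run.NSet[of x "[]" "NAdd (Get x) (NConst 1)" t'] x'
      by (simp add: t2_def eval_nat_numeral)
    then have "run ?body t (m + 4) t2"
      using t'(1) by (rule run.Seq[rotated])
    moreover have "agree (insert x (writes P)) s t2"
    proof (rule agree_trans)
      show "agree (insert x (writes P)) s t'"
        using step.prems(3) agr by (rule agree_trans) auto
      show "agree {x} t' t2"
        by (simp add: t2_def agree_nupd)
    qed auto
    then obtain m' t3 where "run ?W t2 m' t3" "m' \<le> (n - Suc j) * (K + 7) + 3" "Inv n t3"
      using step.IH[of t2] t'(3) unfolding exec_def t2_def by auto
    ultimately have "run ?W t (3 + (m + 4) + m') t3"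
      using run.WhileTrue[of t "NLess (Get x) (Get b)" ?body "m + 4" t2 m' t3] by simp
    moreover have "3 + (m + 4) + m' \<le> (n - j) * (K + 7) + 3"
    proof -
      have "n - j = Suc (n - Suc j)"
        using step.hyps by simp
      then show ?thesis
        using \<open>m \<le> K\<close> \<open>m' \<le> _\<close> by simp
    qed
    ultimately show ?case
      unfolding exec_def using \<open>Inv n t3\<close> by blast
  qed
  show ?thesis
    unfolding For_def
  proof (rule exec_Seq)
    show "exec (NSet x [] (NConst 0)) s 2 (\<lambda>t. t = nupd s x [] 0)"
      by (rule exec_NSet) simp_all
    show "exec ?W t (n * (K + 7) + 3) (Inv n)" if "t = nupd s x [] 0" for t
      using loop[of 0 t] that init by (simp add: agree_nupd)
  qed (use k in simp)
qed

text \<open>Hides the order of traversal: the elements numbered below the counter form the set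
  \<open>Y\<close> of those already visited, and by injectivity of \<nu> each round adds exactly one
  element to it.\<close>

lemma exec_For_bij:
  assumes bij: "bij_betw \<nu> X {..<n}"
    and x: "x \<notin> writes P" and b: "b \<notin> insert x (writes P)" and n: "ntab s b [] = n"
    and init: "Inv {} (nupd s x [] 0)"
    and step: "\<And>Y u t. Y \<subseteq> X \<Longrightarrow> u \<in> X \<Longrightarrow> u \<notin> Y \<Longrightarrow> Inv Y t \<Longrightarrow> ntab t x [] = \<nu> u \<Longrightarrow>
      agree (insert x (writes P)) s t \<Longrightarrow>
      exec P t K (\<lambda>t'. Inv (insert u Y) (nupd t' x [] (Suc (\<nu> u))))"
    and k: "n * (K + 7) + 5 \<le> k"
  shows "exec (For x b P) s k (Inv X)"
proof -
  have "exec (For x b P) s k (\<lambda>t. Inv {u \<in> X. \<nu> u < n} t)"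
  proof (rule exec_For[OF x b n _ _ k])
    show "Inv {u \<in> X. \<nu> u < 0} (nupd s x [] 0)"
      using init by simp
  next
    fix j t assume j: "j < n" "Inv {u \<in> X. \<nu> u < j} t" "ntab t x [] = j"
      "agree (insert x (writes P)) s t"
    obtain u where u: "u \<in> X" "\<nu> u = j"
      using bij j(1) unfolding bij_betw_def by (metis imageE lessThan_iff)
    have "{v \<in> X. \<nu> v < Suc j} = insert u {v \<in> X. \<nu> v < j}"
      using u bij unfolding bij_betw_def inj_on_def by (auto simp: less_Suc_eq)
    then show "exec P t K (\<lambda>t'. Inv {u \<in> X. \<nu> u < Suc j} (nupd t' x [] (Suc j)))"
      using step[of "{v \<in> X. \<nu> v < j}" u t] j u by simp
  qed
  moreover have "{u \<in> X. \<nu> u < n} = X"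
    using bij unfolding bij_betw_def by auto
  ultimately show ?thesis
    by simp
qed

text \<open>The body must change exactly one cell of \<open>y\<close>. Entries written in earlier
  rounds then survive, because distinct elements have distinct numbers.\<close>

lemma exec_For_pointwise:
  assumes bij: "bij_betw \<nu> X {..<n}"
    and x: "x \<notin> writes P" and b: "b \<notin> insert x (writes P)" and n: "ntab s b [] = n"
    and step: "\<And>u t. u \<in> X \<Longrightarrow> ntab t x [] = \<nu> u \<Longrightarrow> agree (insert x (writes P)) s t \<Longrightarrow>
      exec P t K (\<lambda>t'. rtab t' y = (rtab t y)([\<nu> u] := f u))"
    and k: "n * (K + 7) + 5 \<le> k"
  shows "exec (For x b P) s k (\<lambda>t. \<forall>u\<in>X. rtab t y [\<nu> u] = f u)"
proof (rule exec_For_bij[where Inv = "\<lambda>Y t. \<forall>u\<in>Y. rtab t y [\<nu> u] = f u", OF bij x b n _ _ k])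
  fix Y u t
  assume *: "Y \<subseteq> X" "u \<in> X" "u \<notin> Y" "\<forall>u\<in>Y. rtab t y [\<nu> u] = f u" "ntab t x [] = \<nu> u"
    "agree (insert x (writes P)) s t"
  have "\<nu> v \<noteq> \<nu> u" if "v \<in> Y" for v
    using bij * that unfolding bij_betw_def inj_on_def by blast
  then show "exec P t K (\<lambda>t'. \<forall>v\<in>insert u Y. rtab (nupd t' x [] (Suc (\<nu> u))) y [\<nu> v] = f v)"
    by (intro exec_conseq[OF step[OF *(2,5,6)]]) (use *(4) in auto)
qed simp

text \<open>The increment \<open>h u\<close> is a function on all cells of \<open>y\<close>. This
  covers both a scalar accumulator, where only the empty index list receives a term, and a table in
  which each element adds to the cell of its group.\<close>

lemma exec_For_sum:
  fixes h :: "'u \<Rightarrow> nat list \<Rightarrow> real"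
  assumes bij: "bij_betw \<nu> X {..<n}"
    and x: "x \<notin> writes P" and b: "b \<notin> insert x (writes P)" and n: "ntab s b [] = n"
    and step: "\<And>u t. u \<in> X \<Longrightarrow> ntab t x [] = \<nu> u \<Longrightarrow> agree (insert x (writes P)) s t \<Longrightarrow>
      exec P t K (\<lambda>t'. \<forall>is. rtab t' y is = rtab t y is + h u is)"
    and k: "n * (K + 7) + 5 \<le> k"
  shows "exec (For x b P) s k (\<lambda>t. \<forall>is. rtab t y is = rtab s y is + (\<Sum>u\<in>X. h u is))"
proof (rule exec_For_bij[where Inv = "\<lambda>Y t. \<forall>is. rtab t y is = rtab s y is + (\<Sum>u\<in>Y. h u is)",
      OF bij x b n _ _ k])
  fix Y u t
  assume *: "Y \<subseteq> X" "u \<in> X" "u \<notin> Y" "\<forall>is. rtab t y is = rtab s y is + (\<Sum>u\<in>Y. h u is)"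
    "ntab t x [] = \<nu> u" "agree (insert x (writes P)) s t"
  have "finite Y"
    using *(1) bij bij_betw_finite finite_lessThan finite_subset by metis
  then show "exec P t K (\<lambda>t'. \<forall>is. rtab (nupd t' x [] (Suc (\<nu> u))) y is =
      rtab s y is + (\<Sum>u\<in>insert u Y. h u is))"
    by (intro exec_conseq[OF step[OF *(2,5,6)]]) (use *(3,4) in auto)
qed simp

section \<open>Sums, sums by group, and minima\<close>

definition AddTo :: "vname \<Rightarrow> nexp list \<Rightarrow> rexp \<Rightarrow> com" where
  "AddTo y es e = RSet y es (RAdd (RGet y es) e)"

lemma writes_AddTo [simp]: "writes (AddTo y es e) = {y}"
  by (simp add: AddTo_def)

definition SumWhere :: "vname \<Rightarrow> vname \<Rightarrow> bexp \<Rightarrow> vname \<Rightarrow> rexp \<Rightarrow> com" where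
  "SumWhere x b p y e = Seq (RSet y [] (RConst 0)) (For x b (Cond p (AddTo y [] e) Skip))"

lemma writes_SumWhere [simp]: "writes (SumWhere x b p y e) = {x, y}"
  by (auto simp: SumWhere_def)

text \<open>\<open>R\<close> is the context in which the test and the summand can be evaluated; it
  has to survive changes of the counter and the accumulator only. The accumulator is reset at cost
  2, which makes the program usable inside another loop; with the 5 of the loop this gives the 7 in
  the bound.\<close>

lemma exec_SumWhere:
  assumes bij: "bij_betw \<nu> X {..<n}"
    and names: "x \<noteq> y" "b \<noteq> x" "b \<noteq> y" and n: "ntab s b [] = n"
    and R: "\<And>t. agree {x, y} s t \<Longrightarrow> R t"
    and eval: "\<And>u t. R t \<Longrightarrow> u \<in> X \<Longrightarrow> ntab t x [] = \<nu> u \<Longrightarrow> bval t p = q u \<and> rval t e = f u"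
    and k: "n * (bcost p + rcost e + 10) + 7 \<le> k"
  shows "exec (SumWhere x b p y e) s k (\<lambda>t. R t \<and> rtab t y [] = (\<Sum>u\<in>{u \<in> X. q u}. f u))"
  unfolding SumWhere_def
proof (rule exec_Seq)
  show "exec (RSet y [] (RConst 0)) s 2 (\<lambda>t. t = rupd s y [] 0)"
    by (rule exec_RSet) simp_all
  fix t assume t: "t = rupd s y [] 0"
  have "exec (For x b (Cond p (AddTo y [] e) Skip)) t (n * (bcost p + rcost e + 10) + 5)
    (\<lambda>t'. \<forall>is. rtab t' y is = rtab t y is + (\<Sum>u\<in>X. if is = [] \<and> q u then f u else 0))"
  proof (rule exec_For_sum[OF bij])
    fix u t' assume u: "u \<in> X" "ntab t' x [] = \<nu> u"
      "agree (insert x (writes (Cond p (AddTo y [] e) Skip))) t t'"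
    have "agree {x, y} s t'"
      by (rule agree_trans[OF _ u(3), of "{y}"]) (auto simp: t agree_def)
    with R eval u have ev: "bval t' p = q u" "rval t' e = f u"
      by blast+
    show "exec (Cond p (AddTo y [] e) Skip) t' (bcost p + (rcost e + 3))
      (\<lambda>t''. \<forall>is. rtab t'' y is = rtab t' y is + (if is = [] \<and> q u then f u else 0))"
      unfolding AddTo_def
      by (rule exec_Cond[where k = "rcost e + 3"]; (rule exec_RSet exec_Skip)?) (auto simp: ev)
  qed (insert names n, simp_all add: t)
  then show "exec (For x b (Cond p (AddTo y [] e) Skip)) t (n * (bcost p + rcost e + 10) + 5)
    (\<lambda>t. R t \<and> rtab t y [] = (\<Sum>u\<in>{u \<in> X. q u}. f u))"
  proof (rule exec_conseq)
    fix t' assume sums: "\<forall>is. rtab t' y is = rtab t y is + (\<Sum>u\<in>X. if is = [] \<and> q u then f u else 0)"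
      and agr: "agree (writes (For x b (Cond p (AddTo y [] e) Skip))) t t'"
    have "agree {x, y} s t'"
      by (rule agree_trans[OF _ agr, of "{y}"]) (auto simp: t agree_def)
    moreover have "finite X"
      using bij bij_betw_finite finite_lessThan by metis
    ultimately show "R t' \<and> rtab t' y [] = (\<Sum>u\<in>{u \<in> X. q u}. f u)"
      using R sums by (simp add: t sum.inter_filter)
  qed simp
qed (use k in simp)

definition ScatterAdd :: "vname \<Rightarrow> vname \<Rightarrow> vname \<Rightarrow> nexp \<Rightarrow> rexp \<Rightarrow> com" where
  "ScatterAdd x b y g e = For x b (AddTo y [g] e)"

lemma writes_ScatterAdd [simp]: "writes (ScatterAdd x b y g e) = {x, y}"
  by (auto simp: ScatterAdd_def)

text \<open>The table is required to be zero beforehand instead of being cleared, so this program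
  serves for tables that are filled once. The index \<open>g\<close> is evaluated for the read and
  again for the write, hence \<open>2 * ncost g\<close>.\<close>

lemma exec_ScatterAdd:
  assumes bij: "bij_betw \<nu> X {..<n}"
    and names: "x \<noteq> y" "b \<noteq> x" "b \<noteq> y" and n: "ntab s b [] = n" and zero: "\<And>is. rtab s y is = 0"
    and eval: "\<And>u t. u \<in> X \<Longrightarrow> ntab t x [] = \<nu> u \<Longrightarrow> agree {x, y} s t \<Longrightarrow>
      nval t g = G u \<and> rval t e = f u"
    and k: "n * (2 * ncost g + rcost e + 10) + 5 \<le> k"
  shows "exec (ScatterAdd x b y g e) s k (\<lambda>t. \<forall>h. rtab t y [h] = (\<Sum>u\<in>{u \<in> X. G u = h}. f u))"
proof -
  have "exec (ScatterAdd x b y g e) s k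
    (\<lambda>t'. \<forall>is. rtab t' y is = rtab s y is + (\<Sum>u\<in>X. if [G u] = is then f u else 0))"
    unfolding ScatterAdd_def
  proof (rule exec_For_sum[OF bij])
    fix u t assume u: "u \<in> X" "ntab t x [] = \<nu> u" "agree (insert x (writes (AddTo y [g] e))) s t"
    then have ev: "nval t g = G u" "rval t e = f u"
      using eval by auto
    show "exec (AddTo y [g] e) t (2 * ncost g + rcost e + 3)
      (\<lambda>t'. \<forall>is. rtab t' y is = rtab t y is + (if [G u] = is then f u else 0))"
      unfolding AddTo_def by (rule exec_RSet) (auto simp: ev)
  qed (use names n k in \<open>auto simp: algebra_simps\<close>)
  then show ?thesis
  proof (rule exec_conseq)
    fix t assume "\<forall>is. rtab t y is = rtab s y is + (\<Sum>u\<in>X. if [G u] = is then f u else 0)"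
    moreover have "finite X"
      using bij bij_betw_finite finite_lessThan by metis
    ultimately show "\<forall>h. rtab t y [h] = (\<Sum>u\<in>{u \<in> X. G u = h}. f u)"
      by (simp add: zero sum.inter_filter)
  qed simp
qed

definition Minimum :: "vname \<Rightarrow> vname \<Rightarrow> vname \<Rightarrow> vname \<Rightarrow> com" where
  "Minimum x b z y = Seq (RSet z [] (RGet y [NConst 0]))
     (For x b (Cond (RLess (RGet y [Get x]) (RGet z [])) (RSet z [] (RGet y [Get x])) Skip))"

lemma writes_Minimum [simp]: "writes (Minimum x b z y) = {x, z}"
  by (auto simp: Minimum_def)

lemma exec_Minimum:
  fixes f :: "'u \<Rightarrow> real"
  assumes bij: "bij_betw \<nu> X {..<n}" and "X \<noteq> {}"
    and names: "x \<noteq> z" "b \<noteq> x" "b \<noteq> z" "y \<noteq> x" "y \<noteq> z" and n: "ntab s b [] = n"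
    and f: "\<And>u. u \<in> X \<Longrightarrow> rtab s y [\<nu> u] = f u"
    and k: "n * 14 + 8 \<le> k"
  shows "exec (Minimum x b z y) s k (\<lambda>t. rtab t z [] = Min (f ` X))"
proof -
  have fin: "finite X"
    using bij bij_betw_finite finite_lessThan by metis
  have "n = card X"
    using bij_betw_same_card[OF bij] by simp
  \<comment> \<open>Entry 0 belongs to some element \<open>w\<close>. Starting from its value keeps
    the minimum in the invariant nonempty before any round, and inserting \<open>f w\<close> has no
    effect once all of \<open>X\<close> has been visited.\<close>
  with fin \<open>X \<noteq> {}\<close> have "0 \<in> {..<n}"
    by (simp add: card_gt_0_iff)
  then obtain w where w: "w \<in> X" "\<nu> w = 0"
    using bij unfolding bij_betw_def by (metis imageE)
  show ?thesis
    unfolding Minimum_def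
  proof (rule exec_Seq)
    show "exec (RSet z [] (RGet y [NConst 0])) s 3 (\<lambda>t. t = rupd s z [] (f w))"
      by (rule exec_RSet) (simp_all add: f[OF w(1), unfolded w(2)])
    fix t assume t: "t = rupd s z [] (f w)"
    let ?P = "Cond (RLess (RGet y [Get x]) (RGet z [])) (RSet z [] (RGet y [Get x])) Skip"
    have "exec (For x b ?P) t (n * 14 + 5) (\<lambda>t. rtab t z [] = Min (insert (f w) (f ` X)))"
    proof (rule exec_For_bij[where Inv = "\<lambda>Y t. rtab t z [] = Min (insert (f w) (f ` Y))", OF bij])
      fix Y u t'
      assume *: "Y \<subseteq> X" "u \<in> X" "u \<notin> Y" "rtab t' z [] = Min (insert (f w) (f ` Y))"
        "ntab t' x [] = \<nu> u" "agree (insert x (writes ?P)) t t'"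
      have "finite Y"
        using *(1) fin finite_subset by blast
      have y: "rtab t' y [\<nu> u] = f u"
        using agree_rtab[OF *(6), of y] names f *(2) by (simp add: t)
      have mi: "Min (insert (f w) (f ` insert u Y)) = min (f u) (Min (insert (f w) (f ` Y)))"
        using Min_insert[of "insert (f w) (f ` Y)" "f u"] \<open>finite Y\<close> by (simp add: insert_commute)
      show "exec ?P t' 7 (\<lambda>t'. rtab (nupd t' x [] (Suc (\<nu> u))) z [] = Min (insert (f w) (f ` insert u Y)))"
        unfolding mi
        by (rule exec_Cond[where k = 3]; (rule exec_RSet exec_Skip)?) (auto simp: *(4,5) y min_def)
    qed (insert names n, simp_all add: t)
    then show "exec (For x b ?P) t (n * 14 + 5) (\<lambda>t. rtab t z [] = Min (f ` X))"
      using w(1) by (simp add: insert_absorb)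
  qed (use k in simp)
qed

section \<open>Grouping users by their classes\<close>

text \<open>
  A group is named by its least member, which is the first one met in a pass over the users; the
  successor leaves \<open>0\<close> free to mark the table entries not yet met.
\<close>

fun group_id :: "(nat \<Rightarrow> nat \<Rightarrow> nat) \<Rightarrow> nat \<Rightarrow> nat \<Rightarrow> nat" where
  "group_id a 0 u = 0"
| "group_id a (Suc j) u =
     Suc (LEAST w. group_id a j w = group_id a j u \<and> a w (Suc j) = a u (Suc j))"

text \<open>The least member of a class lies in it, because the class of \<open>u\<close> contains
  \<open>u\<close>. Two classes with the same least member thus share an element and coincide. So a
  group number carries exactly the information of the first \<open>j\<close> classes.\<close>

lemma group_id_eq_iff:
  "group_id a j u = group_id a j v \<longleftrightarrow> (\<forall>i\<in>{1..j}. a u i = a v i)"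
proof (induction j)
  case (Suc j)
  define P where "P u w \<longleftrightarrow> group_id a j w = group_id a j u \<and> a w (Suc j) = a u (Suc j)" for u w
  have id: "group_id a (Suc j) u = Suc (LEAST w. P u w)" for u
    by (simp add: P_def)
  have least: "P u (LEAST w. P u w)" for u
    by (rule LeastI[of "P u" u]) (simp add: P_def)
  have "group_id a (Suc j) u = group_id a (Suc j) v \<longleftrightarrow> P v u"
  proof
    assume "group_id a (Suc j) u = group_id a (Suc j) v"
    then have "(LEAST w. P u w) = (LEAST w. P v w)"
      unfolding id by simp
    with least[of u] least[of v] show "P v u"
      unfolding P_def by metis
  next
    assume "P v u"
    then have "P u = P v"
      unfolding P_def by auto
    then show "group_id a (Suc j) u = group_id a (Suc j) v"
      unfolding id by simp
  qed
  also have "\<dots> \<longleftrightarrow> (\<forall>i\<in>{1..Suc j}. a u i = a v i)"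
    unfolding P_def Suc.IH by (auto simp: atLeastAtMostSuc_conv)
  finally show ?case .
qed simp

text \<open>The leading index gives every attribute its own layer of \<open>T\<close>. The counter
  starts at 0 while attributes are numbered from 1, hence the increment in the index of
  \<open>A\<close>.\<close>

definition class_cell :: "nexp list" where
  "class_cell = [Get ''j'', NGet ''g'' [Get ''u''], NGet ''A'' [Get ''u'', NAdd (Get ''j'') (NConst 1)]]"

definition refine_com :: com where
  "refine_com = Seq
     (Cond (NEq (NGet ''T'' class_cell) (NConst 0)) (NSet ''T'' class_cell (NAdd (Get ''u'') (NConst 1))) Skip)
     (NSet ''g'' [Get ''u''] (NGet ''T'' class_cell))"

definition group_com :: com where
  "group_com = For ''j'' ''k'' (For ''u'' ''U'' refine_com)"

lemma writes_refine_com [simp]: "writes refine_com = {''T'', ''g''}"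
  by (auto simp: refine_com_def)

lemma writes_group_com [simp]: "writes group_com = {''j'', ''u'', ''T'', ''g''}"
  by (auto simp: group_com_def)

text \<open>Table \<open>g\<close> is overwritten in place, which is safe because each user reads
  only its own entry. The constant 41 is 7 for the loop plus 34 for the body: 23 for the conditional
  and 11 for the assignment to \<open>g\<close>.\<close>

lemma exec_refine_all:
  assumes U: "ntab s ''U'' [] = n" and j: "ntab s ''j'' [] = j"
    and A: "\<And>u. u < n \<Longrightarrow> ntab s ''A'' [u, Suc j] = a u (Suc j)"
    and g: "\<And>u. u < n \<Longrightarrow> ntab s ''g'' [u] = group_id a j u"
    and T: "\<And>i h c. j \<le> i \<Longrightarrow> ntab s ''T'' [i, h, c] = 0"
  shows "exec (For ''u'' ''U'' refine_com) s (n * 41 + 5)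
    (\<lambda>t. (\<forall>u<n. ntab t ''g'' [u] = group_id a (Suc j) u) \<and>
         (\<forall>i>j. \<forall>h c. ntab t ''T'' [i, h, c] = 0))"
proof -
  define P where "P h c w \<longleftrightarrow> group_id a j w = h \<and> a w (Suc j) = c" for h c w
  define Inv where "Inv m t \<longleftrightarrow>
      (\<forall>u<m. ntab t ''g'' [u] = group_id a (Suc j) u) \<and>
      (\<forall>u<n. m \<le> u \<longrightarrow> ntab t ''g'' [u] = group_id a j u) \<and>
      (\<forall>h c. ntab t ''T'' [j, h, c] = (if \<exists>w<m. P h c w then Suc (LEAST w. P h c w) else 0)) \<and>
      (\<forall>i>j. \<forall>h c. ntab t ''T'' [i, h, c] = 0)" for m and t :: state
  have "exec (For ''u'' ''U'' refine_com) s (n * 41 + 5) (Inv n)"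
  proof (rule exec_For)
    show "Inv 0 (nupd s ''u'' [] 0)"
      using g T by (simp add: Inv_def)
  next
    fix m t
    assume m: "m < n" and inv: "Inv m t" and u: "ntab t ''u'' [] = m"
      and agr: "agree (insert ''u'' (writes refine_com)) s t"
    let ?h = "group_id a j m" and ?c = "a m (Suc j)"
    \<comment> \<open>Only the four tables read by the index list are constrained, so this applies
      both before and after the write to \<open>T\<close>.\<close>
    have cell: "map (nval t') class_cell = [j, ?h, ?c]"
      if "ntab t' ''g'' = ntab t ''g''" "ntab t' ''u'' = ntab t ''u''" "ntab t' ''j'' = ntab t ''j''"
        "ntab t' ''A'' = ntab t ''A''" for t'
      using that u m inv j A[OF m] agree_ntab[OF agr, of "''j''"] agree_ntab[OF agr, of "''A''"]
      by (simp add: class_cell_def Inv_def)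
    have least: "group_id a (Suc j) m = Suc (LEAST w. P ?h ?c w)"
      by (simp add: P_def)
    have Pm: "P ?h ?c m"
      by (simp add: P_def)
    \<comment> \<open>\<open>LEAST\<close> ranges over all naturals, including those that number no
      user. This does no harm: \<open>m\<close> is a candidate, and a first visit means that no
      smaller candidate exists.\<close>
    have new: "(LEAST w. P h c w) = m" if "P h c m" "\<forall>w<m. \<not> P h c w" for h c
      using that by (intro Least_equality) (auto simp: not_less[symmetric])
    \<comment> \<open>One description of \<open>T\<close> for both branches: a first visit writes
      this value, and on a later visit the cell already holds it.\<close>
    define T' where "T' = (ntab t ''T'')([j, ?h, ?c] := Suc (LEAST w. P ?h ?c w))"
    have T': "T' [j, h, c] = (if \<exists>w<Suc m. P h c w then Suc (LEAST w. P h c w) else 0)" for h c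
    proof (cases "h = ?h \<and> c = ?c")
      case True
      then show ?thesis
        using Pm by (auto simp: T'_def)
    next
      case False
      then have "\<not> P h c m"
        by (auto simp: P_def)
      with False inv show ?thesis
        by (auto simp: T'_def Inv_def less_Suc_eq)
    qed
    show "exec refine_com t 34 (\<lambda>t'. Inv (Suc m) (nupd t' ''u'' [] (Suc m)))"
      unfolding refine_com_def
    proof (rule exec_Seq)
      show "exec (Cond (NEq (NGet ''T'' class_cell) (NConst 0))
          (NSet ''T'' class_cell (NAdd (Get ''u'') (NConst 1))) Skip) t 23
        (\<lambda>t'. ntab t' ''T'' = T')"
      proof (rule exec_Cond[where k = 12])
        assume "bval t (NEq (NGet ''T'' class_cell) (NConst 0))"
        then have "\<forall>w<m. \<not> P ?h ?c w"
          using inv cell[of t] by (auto simp: Inv_def split: if_splits)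
        then have "T' = (ntab t ''T'')([j, ?h, ?c] := Suc m)"
          using new[OF Pm] by (simp add: T'_def)
        then show "exec (NSet ''T'' class_cell (NAdd (Get ''u'') (NConst 1))) t 12
            (\<lambda>t'. ntab t' ''T'' = T')"
          by (intro exec_NSet) (simp add: cell u, simp add: class_cell_def)
      next
        assume "\<not> bval t (NEq (NGet ''T'' class_cell) (NConst 0))"
        then have "ntab t ''T'' [j, ?h, ?c] = Suc (LEAST w. P ?h ?c w)"
          using inv cell[of t] by (auto simp: Inv_def split: if_splits)
        then have "ntab t ''T'' = T'"
          by (simp add: T'_def fun_upd_idem)
        then show "exec Skip t 12 (\<lambda>t'. ntab t' ''T'' = T')"
          by (intro exec_Skip) simp_all
      qed (simp add: class_cell_def)
    next
      fix t' assume t': "ntab t' ''T'' = T'"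
        and "agree (writes (Cond (NEq (NGet ''T'' class_cell) (NConst 0))
          (NSet ''T'' class_cell (NAdd (Get ''u'') (NConst 1))) Skip)) t t'"
      then have same: "ntab t' y = ntab t y" if "y \<noteq> ''T''" for y
        using that by (simp add: agree_def)
      show "exec (NSet ''g'' [Get ''u''] (NGet ''T'' class_cell)) t' 11
        (\<lambda>t'. Inv (Suc m) (nupd t' ''u'' [] (Suc m)))"
      proof (rule exec_NSet)
        have "nval t' (NGet ''T'' class_cell) = group_id a (Suc j) m"
          using T'[of ?h ?c] Pm by (auto simp: cell same t' least simp del: group_id.simps)
        moreover have "T' [i, h, c] = 0" if "i > j" for i h c
          using that inv by (simp add: T'_def Inv_def)
        ultimately show "Inv (Suc m) (nupd (nupd t' ''g'' (map (nval t') [Get ''u''])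
            (nval t' (NGet ''T'' class_cell))) ''u'' [] (Suc m))"
          using inv T' by (auto simp: Inv_def same t' u less_Suc_eq simp del: group_id.simps)
      qed (simp add: class_cell_def)
    qed simp
  qed (use U in simp_all)
  then show ?thesis
    by (rule exec_conseq) (auto simp: Inv_def)
qed

text \<open>The zero initialisation is used twice: \<open>g\<close> is already correct for no
  attributes, where all users form group 0, and all layers of \<open>T\<close> are empty. The
  invariant keeps the layers from \<open>j\<close> on empty, so that nothing is ever
  cleared.\<close>

lemma exec_group_com:
  assumes U: "ntab s ''U'' [] = n" and k: "ntab s ''k'' [] = k"
    and A: "\<And>u j. u < n \<Longrightarrow> j \<in> {1..k} \<Longrightarrow> ntab s ''A'' [u, j] = a u j"
    and zero: "\<And>is. ntab s ''g'' is = 0" "\<And>is. ntab s ''T'' is = 0"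
  shows "exec group_com s (k * (n * 41 + 12) + 5) (\<lambda>t. \<forall>u<n. ntab t ''g'' [u] = group_id a k u)"
proof -
  have "exec group_com s (k * (n * 41 + 12) + 5)
    (\<lambda>t. (\<forall>u<n. ntab t ''g'' [u] = group_id a k u) \<and> (\<forall>i\<ge>k. \<forall>h c. ntab t ''T'' [i, h, c] = 0))"
    unfolding group_com_def
  proof (rule exec_For[where Inv = "\<lambda>j t. (\<forall>u<n. ntab t ''g'' [u] = group_id a j u) \<and>
      (\<forall>i\<ge>j. \<forall>h c. ntab t ''T'' [i, h, c] = 0)"])
    fix j t
    assume "j < k" "(\<forall>u<n. ntab t ''g'' [u] = group_id a j u) \<and>
      (\<forall>i\<ge>j. \<forall>h c. ntab t ''T'' [i, h, c] = 0)" "ntab t ''j'' [] = j"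
      "agree (insert ''j'' (writes (For ''u'' ''U'' refine_com))) s t"
    then have "exec (For ''u'' ''U'' refine_com) t (n * 41 + 5)
      (\<lambda>t. (\<forall>u<n. ntab t ''g'' [u] = group_id a (Suc j) u) \<and>
         (\<forall>i>j. \<forall>h c. ntab t ''T'' [i, h, c] = 0))"
      using U A by (intro exec_refine_all) (auto simp: agree_def simp del: group_id.simps)
    then show "exec (For ''u'' ''U'' refine_com) t (n * 41 + 5)
      (\<lambda>t'. (\<forall>u<n. ntab (nupd t' ''j'' [] (Suc j)) ''g'' [u] = group_id a (Suc j) u) \<and>
         (\<forall>i\<ge>Suc j. \<forall>h c. ntab (nupd t' ''j'' [] (Suc j)) ''T'' [i, h, c] = 0))"
      by (rule exec_conseq) (auto simp: Suc_le_eq simp del: group_id.simps)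
  qed (use k zero in simp_all)
  then show ?thesis
    by (rule exec_conseq) auto
qed


section \<open>The mitigation step\<close>

text \<open>Lets assertions pile up along a sequence nested to the left, where \<open>R\<close>
  survives \<open>P'\<close> by its frame.\<close>

lemma exec_Seq_keep:
  assumes "exec P s k1 R" and "\<And>t. R t \<Longrightarrow> exec P' t k2 Q"
    and "\<And>t t'. R t \<Longrightarrow> agree (writes P') t t' \<Longrightarrow> R t'" and "k1 + k2 \<le> k"
  shows "exec (Seq P P') s k (\<lambda>t. R t \<and> Q t)"
  using assms(1)
proof (rule exec_Seq)
  show "exec P' t k2 (\<lambda>t. R t \<and> Q t)" if "R t" for t
    using assms(2)[OF that] by (rule exec_conseq) (use assms(3) that in auto)
qed (rule assms(4))

text \<open>
  The tables \<open>S\<close>, \<open>C\<close>, \<open>V\<close> (sum, size, sum of squared deviations) are indexed by group numbers,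
  whereas \<open>m\<close> and \<open>d\<close> store the average and deviation of the group of each user.
\<close>

definition sums_com :: com where
  "sums_com = Seq (ScatterAdd ''u'' ''U'' ''S'' (NGet ''g'' [Get ''u'']) (RGet ''q'' [Get ''u'']))
     (ScatterAdd ''u'' ''U'' ''C'' (NGet ''g'' [Get ''u'']) (RConst 1))"

definition avg_com :: com where
  "avg_com = For ''u'' ''U'' (RSet ''m'' [Get ''u'']
     (RDiv (RGet ''S'' [NGet ''g'' [Get ''u'']]) (RGet ''C'' [NGet ''g'' [Get ''u'']])))"

definition squares_com :: com where
  "squares_com = ScatterAdd ''u'' ''U'' ''V'' (NGet ''g'' [Get ''u''])
     (RMul (RSub (RGet ''q'' [Get ''u'']) (RGet ''m'' [Get ''u'']))
        (RSub (RGet ''q'' [Get ''u'']) (RGet ''m'' [Get ''u''])))"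

definition std_com :: com where
  "std_com = For ''u'' ''U'' (RSet ''d'' [Get ''u'']
     (RSqrt (RDiv (RGet ''V'' [NGet ''g'' [Get ''u'']]) (RGet ''C'' [NGet ''g'' [Get ''u'']]))))"

definition shift_com :: com where
  "shift_com = For ''u'' ''U'' (RSet ''c'' [Get ''u''] (RAdd (RGet ''mu'' [])
     (RMul (RSub (RGet ''q'' [Get ''u'']) (RGet ''m'' [Get ''u'']))
        (RDiv (RGet ''sd'' []) (RGet ''d'' [Get ''u''])))))"

definition mitigate_com :: com where
  "mitigate_com = Seq (Seq (Seq (Seq (Seq (Seq sums_com avg_com) squares_com) std_com)
     (Minimum ''u'' ''U'' ''mu'' ''m'')) (Minimum ''u'' ''U'' ''sd'' ''d'')) shift_com"

lemma writes_mitigate_com [simp]: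
  "writes mitigate_com = {''u'', ''S'', ''C'', ''m'', ''V'', ''d'', ''mu'', ''sd'', ''c''}"
  by (auto simp: mitigate_com_def sums_com_def avg_com_def squares_com_def std_com_def shift_com_def)

text \<open>Stated for an arbitrary reputation table \<open>q\<close> and arbitrary group numbers
  \<open>G\<close>: the groups enter only as the fibres \<open>B u\<close> of \<open>G\<close>. The
  numerals in the bound add up those of the seven passes, \<open>sums_com\<close> contributing two
  loops as one of them.\<close>

lemma exec_mitigate_com:
  fixes q :: "'u \<Rightarrow> real"
  assumes bij: "bij_betw \<nu> X {..<n}" and ne: "X \<noteq> {}" and U: "ntab s ''U'' [] = n"
    and g: "\<And>u. u \<in> X \<Longrightarrow> ntab s ''g'' [\<nu> u] = G u"
    and q: "\<And>u. u \<in> X \<Longrightarrow> rtab s ''q'' [\<nu> u] = q u"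
    and zero: "\<And>y is. y \<in> {''S'', ''C'', ''V''} \<Longrightarrow> rtab s y is = 0"
  defines "B \<equiv> \<lambda>u. {v \<in> X. G v = G u}"
  shows "exec mitigate_com s (n * 138 + 46) (\<lambda>t. \<forall>u\<in>X. rtab t ''c'' [\<nu> u] =
     Min ((\<lambda>u. avg q (B u)) ` X) +
     (q u - avg q (B u)) * (Min ((\<lambda>u. std q (B u)) ` X) / std q (B u)))"
proof -
  define R0 where "R0 t \<longleftrightarrow> ntab t ''U'' [] = n \<and> (\<forall>u\<in>X. ntab t ''g'' [\<nu> u] = G u) \<and>
    (\<forall>u\<in>X. rtab t ''q'' [\<nu> u] = q u)" for t :: state
  have 1: "exec sums_com s (n * 31 + 10) (\<lambda>t.
      (R0 t \<and> (\<forall>is. rtab t ''V'' is = 0)) \<and>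
      (\<forall>h. rtab t ''S'' [h] = (\<Sum>u\<in>{u \<in> X. G u = h}. q u)) \<and>
      (\<forall>h. rtab t ''C'' [h] = (\<Sum>u\<in>{u \<in> X. G u = h}. 1)))"
    unfolding sums_com_def
  proof (rule exec_Seq)
    show "exec (ScatterAdd ''u'' ''U'' ''S'' (NGet ''g'' [Get ''u'']) (RGet ''q'' [Get ''u''])) s
        (n * 16 + 5) (\<lambda>t. \<forall>h. rtab t ''S'' [h] = (\<Sum>u\<in>{u \<in> X. G u = h}. q u))"
      by (rule exec_ScatterAdd[OF bij]) (auto simp: agree_def U g q zero)
    fix t assume t: "\<forall>h. rtab t ''S'' [h] = (\<Sum>u\<in>{u \<in> X. G u = h}. q u)"
      and agr: "agree (writes (ScatterAdd ''u'' ''U'' ''S'' (NGet ''g'' [Get ''u'']) (RGet ''q'' [Get ''u'']))) s t"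
    have "exec (ScatterAdd ''u'' ''U'' ''C'' (NGet ''g'' [Get ''u'']) (RConst 1)) t
        (n * 15 + 5) (\<lambda>t. \<forall>h. rtab t ''C'' [h] = (\<Sum>u\<in>{u \<in> X. G u = h}. 1))"
      by (rule exec_ScatterAdd[OF bij]) (use agr in \<open>auto simp: agree_def U g zero\<close>)
    then show "exec (ScatterAdd ''u'' ''U'' ''C'' (NGet ''g'' [Get ''u'']) (RConst 1)) t (n * 15 + 5)
      (\<lambda>t. (R0 t \<and> (\<forall>is. rtab t ''V'' is = 0)) \<and>
      (\<forall>h. rtab t ''S'' [h] = (\<Sum>u\<in>{u \<in> X. G u = h}. q u)) \<and>
      (\<forall>h. rtab t ''C'' [h] = (\<Sum>u\<in>{u \<in> X. G u = h}. 1)))"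
      by (rule exec_conseq) (use agr t in \<open>auto simp: R0_def agree_def U g q zero\<close>)
  qed simp
  have 2: "exec (Seq sums_com avg_com) s (n * 47 + 15) (\<lambda>t.
      ((R0 t \<and> (\<forall>is. rtab t ''V'' is = 0)) \<and>
      (\<forall>h. rtab t ''S'' [h] = (\<Sum>u\<in>{u \<in> X. G u = h}. q u)) \<and>
      (\<forall>h. rtab t ''C'' [h] = (\<Sum>u\<in>{u \<in> X. G u = h}. 1))) \<and>
      (\<forall>u\<in>X. rtab t ''m'' [\<nu> u] = avg q (B u)))"
    using 1
  proof (rule exec_Seq_keep)
    fix t assume t: "(R0 t \<and> (\<forall>is. rtab t ''V'' is = 0)) \<and>
      (\<forall>h. rtab t ''S'' [h] = (\<Sum>u\<in>{u \<in> X. G u = h}. q u)) \<and>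
      (\<forall>h. rtab t ''C'' [h] = (\<Sum>u\<in>{u \<in> X. G u = h}. 1))"
    show "exec avg_com t (n * 16 + 5) (\<lambda>t. \<forall>u\<in>X. rtab t ''m'' [\<nu> u] = avg q (B u))"
      unfolding avg_com_def
      by (rule exec_For_pointwise[OF bij, where K = 9]; (rule exec_RSet)?)
        (use t in \<open>auto simp: agree_def R0_def avg_def B_def\<close>)
  qed (auto simp: avg_com_def R0_def agree_def)
  have 3: "exec (Seq (Seq sums_com avg_com) squares_com) s (n * 72 + 20) (\<lambda>t.
      (R0 t \<and> (\<forall>h. rtab t ''C'' [h] = (\<Sum>u\<in>{u \<in> X. G u = h}. 1)) \<and>
      (\<forall>u\<in>X. rtab t ''m'' [\<nu> u] = avg q (B u))) \<and>
      (\<forall>h. rtab t ''V'' [h] = (\<Sum>u\<in>{u \<in> X. G u = h}. (q u - avg q (B u))\<^sup>2)))"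
    using 2
  proof (rule exec_Seq)
    fix t assume t: "((R0 t \<and> (\<forall>is. rtab t ''V'' is = 0)) \<and>
      (\<forall>h. rtab t ''S'' [h] = (\<Sum>u\<in>{u \<in> X. G u = h}. q u)) \<and>
      (\<forall>h. rtab t ''C'' [h] = (\<Sum>u\<in>{u \<in> X. G u = h}. 1))) \<and>
      (\<forall>u\<in>X. rtab t ''m'' [\<nu> u] = avg q (B u))"
    have "exec squares_com t (n * 25 + 5)
      (\<lambda>t. \<forall>h. rtab t ''V'' [h] = (\<Sum>u\<in>{u \<in> X. G u = h}. (q u - avg q (B u))\<^sup>2))"
      unfolding squares_com_def
      by (rule exec_ScatterAdd[OF bij]) (use t in \<open>auto simp: agree_def R0_def power2_eq_square\<close>)
    then show "exec squares_com t (n * 25 + 5) (\<lambda>t.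
      (R0 t \<and> (\<forall>h. rtab t ''C'' [h] = (\<Sum>u\<in>{u \<in> X. G u = h}. 1)) \<and>
      (\<forall>u\<in>X. rtab t ''m'' [\<nu> u] = avg q (B u))) \<and>
      (\<forall>h. rtab t ''V'' [h] = (\<Sum>u\<in>{u \<in> X. G u = h}. (q u - avg q (B u))\<^sup>2)))"
      by (rule exec_conseq) (use t in \<open>auto simp: squares_com_def R0_def agree_def\<close>)
  qed simp
  \<comment> \<open>The pass over the squares subtracts from each user the average stored for that
    same user. Members of one group have the same fibre \<open>B\<close>, so this is the common
    average required by \<open>std\<close>.\<close>
  have same_group: "(\<Sum>v\<in>B u. (q v - avg q (B v))\<^sup>2) = (\<Sum>v\<in>B u. (q v - avg q (B u))\<^sup>2)" for u
    by (rule sum.cong) (auto simp: B_def)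
  have 4: "exec (Seq (Seq (Seq sums_com avg_com) squares_com) std_com) s (n * 89 + 25) (\<lambda>t.
      ((R0 t \<and> (\<forall>h. rtab t ''C'' [h] = (\<Sum>u\<in>{u \<in> X. G u = h}. 1)) \<and>
      (\<forall>u\<in>X. rtab t ''m'' [\<nu> u] = avg q (B u))) \<and>
      (\<forall>h. rtab t ''V'' [h] = (\<Sum>u\<in>{u \<in> X. G u = h}. (q u - avg q (B u))\<^sup>2))) \<and>
      (\<forall>u\<in>X. rtab t ''d'' [\<nu> u] = std q (B u)))"
    using 3
  proof (rule exec_Seq_keep)
    fix t assume t: "(R0 t \<and> (\<forall>h. rtab t ''C'' [h] = (\<Sum>u\<in>{u \<in> X. G u = h}. 1)) \<and>
      (\<forall>u\<in>X. rtab t ''m'' [\<nu> u] = avg q (B u))) \<and>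
      (\<forall>h. rtab t ''V'' [h] = (\<Sum>u\<in>{u \<in> X. G u = h}. (q u - avg q (B u))\<^sup>2))"
    have std: "std q (B u) = sqrt ((\<Sum>v\<in>{v \<in> X. G v = G u}. (q v - avg q (B v))\<^sup>2) /
        (\<Sum>v\<in>{v \<in> X. G v = G u}. 1))" for u
      using same_group[of u] by (simp add: std_def B_def)
    show "exec std_com t (n * 17 + 5) (\<lambda>t. \<forall>u\<in>X. rtab t ''d'' [\<nu> u] = std q (B u))"
      unfolding std_com_def
      by (rule exec_For_pointwise[OF bij, where K = 10]; (rule exec_RSet)?)
        (use t in \<open>auto simp: agree_def R0_def std\<close>)
  qed (auto simp: std_com_def R0_def agree_def)
  define R1 where "R1 t \<longleftrightarrow> R0 t \<and> (\<forall>u\<in>X. rtab t ''m'' [\<nu> u] = avg q (B u)) \<and>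
      (\<forall>u\<in>X. rtab t ''d'' [\<nu> u] = std q (B u))" for t :: state
  have 5: "exec (Seq (Seq (Seq sums_com avg_com) squares_com) std_com) s (n * 89 + 25) R1"
    using 4 by (rule exec_conseq) (auto simp: R1_def)
  have 6: "exec (Seq (Seq (Seq (Seq sums_com avg_com) squares_com) std_com)
      (Minimum ''u'' ''U'' ''mu'' ''m'')) s (n * 103 + 33)
      (\<lambda>t. R1 t \<and> rtab t ''mu'' [] = Min ((\<lambda>u. avg q (B u)) ` X))"
    using 5
  proof (rule exec_Seq_keep)
    show "exec (Minimum ''u'' ''U'' ''mu'' ''m'') t (n * 14 + 8)
      (\<lambda>t. rtab t ''mu'' [] = Min ((\<lambda>u. avg q (B u)) ` X))" if "R1 t" for t
      by (rule exec_Minimum[OF bij ne]) (use that in \<open>auto simp: R1_def R0_def\<close>)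
  qed (auto simp: R1_def R0_def agree_def)
  have 7: "exec (Seq (Seq (Seq (Seq (Seq sums_com avg_com) squares_com) std_com)
      (Minimum ''u'' ''U'' ''mu'' ''m'')) (Minimum ''u'' ''U'' ''sd'' ''d'')) s (n * 117 + 41)
      (\<lambda>t. (R1 t \<and> rtab t ''mu'' [] = Min ((\<lambda>u. avg q (B u)) ` X)) \<and>
        rtab t ''sd'' [] = Min ((\<lambda>u. std q (B u)) ` X))"
    using 6
  proof (rule exec_Seq_keep)
    show "exec (Minimum ''u'' ''U'' ''sd'' ''d'') t (n * 14 + 8)
      (\<lambda>t. rtab t ''sd'' [] = Min ((\<lambda>u. std q (B u)) ` X))"
      if "R1 t \<and> rtab t ''mu'' [] = Min ((\<lambda>u. avg q (B u)) ` X)" for t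
      by (rule exec_Minimum[OF bij ne]) (use that in \<open>auto simp: R1_def R0_def\<close>)
  qed (auto simp: R1_def R0_def agree_def)
  show ?thesis
    unfolding mitigate_com_def using 7
  proof (rule exec_Seq)
    fix t assume t: "(R1 t \<and> rtab t ''mu'' [] = Min ((\<lambda>u. avg q (B u)) ` X)) \<and>
        rtab t ''sd'' [] = Min ((\<lambda>u. std q (B u)) ` X)"
    show "exec shift_com t (n * 21 + 5) (\<lambda>t. \<forall>u\<in>X. rtab t ''c'' [\<nu> u] =
       Min ((\<lambda>u. avg q (B u)) ` X) +
       (q u - avg q (B u)) * (Min ((\<lambda>u. std q (B u)) ` X) / std q (B u)))"
      unfolding shift_com_def
      by (rule exec_For_pointwise[OF bij, where K = 14]; (rule exec_RSet)?)
        (use t in \<open>auto simp: agree_def R1_def R0_def\<close>)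
  qed simp
qed


section \<open>The ranking scheme\<close>

definition rated_test :: bexp where
  "rated_test = RLess (RConst 0) (RGet ''R'' [Get ''u'', Get ''i''])"

text \<open>The name of the reputation table is a parameter because the same formula is applied to
  \<open>q\<close> in every iteration and to the mitigated reputations \<open>c\<close> at the
  end.\<close>

definition ranking_com :: "vname \<Rightarrow> com" where
  "ranking_com c = For ''i'' ''I'' (Seq (Seq
     (SumWhere ''u'' ''U'' rated_test ''num''
        (RMul (RGet ''R'' [Get ''u'', Get ''i'']) (RGet c [Get ''u''])))
     (SumWhere ''u'' ''U'' rated_test ''den'' (RGet c [Get ''u''])))
     (RSet ''r'' [Get ''i''] (RDiv (RGet ''num'' []) (RGet ''den'' []))))"

definition deviation :: rexp where
  "deviation = RSub (RGet ''R'' [Get ''u'', Get ''i'']) (RGet ''r'' [Get ''i''])"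

text \<open>The language has no absolute value, so \<open>\<bar>x\<bar>\<close> is computed as \<open>sqrt (x * x)\<close>.\<close>

definition reputation_com :: com where
  "reputation_com = For ''u'' ''U'' (Seq (Seq
     (SumWhere ''i'' ''I'' rated_test ''num'' (RSqrt (RMul deviation deviation)))
     (SumWhere ''i'' ''I'' rated_test ''den'' (RConst 1)))
     (RSet ''q'' [Get ''u''] (RSub (RConst 1)
        (RMul (RDiv (RGet ''lambda'' []) (RGet ''den'' [])) (RGet ''num'' [])))))"

definition base_com :: com where
  "base_com = Seq (For ''u'' ''U'' (RSet ''q'' [Get ''u''] (RGet ''c0'' [Get ''u''])))
     (For ''t'' ''N'' (Seq (ranking_com ''q'') reputation_com))"

definition mitigated_ranking_com :: com where
  "mitigated_ranking_com = Seq (Seq (Seq base_com group_com) mitigate_com) (ranking_com ''c'')"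

lemma writes_ranking_com [simp]: "writes (ranking_com c) = {''i'', ''u'', ''num'', ''den'', ''r''}"
  by (auto simp: ranking_com_def)

lemma writes_reputation_com [simp]: "writes reputation_com = {''i'', ''u'', ''num'', ''den'', ''q''}"
  by (auto simp: reputation_com_def)

lemma writes_base_com [simp]:
  "writes base_com = {''t'', ''i'', ''u'', ''num'', ''den'', ''r'', ''q''}"
  by (auto simp: base_com_def)

section \<open>The iterations on given input data\<close>

locale ranking_input =
  fixes D :: "('u, 'i, 'a) rating_data" and N :: nat
    and \<nu> :: "'u \<Rightarrow> nat" and \<iota> :: "'i \<Rightarrow> nat" and \<kappa> :: "nat \<Rightarrow> 'a \<Rightarrow> nat" and s0 :: state
  assumes wf: "wf_data D" and N: "N > 0"
    and numbering: "numbering D \<nu> \<iota> \<kappa>" and input: "input_state D N \<nu> \<iota> \<kappa> s0"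
begin

definition inputs :: "vname set" where
  "inputs = {''U'', ''I'', ''k'', ''N'', ''A'', ''lambda'', ''R'', ''c0''}"

text \<open>\<open>agree\<close> takes the names that may change, hence the complement: everything
  except the input tables is free.\<close>

definition intact :: "state \<Rightarrow> bool" where
  "intact t \<longleftrightarrow> agree (- inputs) s0 t"

lemma intact_agree: "intact s \<Longrightarrow> agree W s t \<Longrightarrow> W \<inter> inputs = {} \<Longrightarrow> intact t"
  unfolding intact_def by (rule agree_trans) auto

lemma bij_users: "bij_betw \<nu> (users D) {..<card (users D)}"
  and bij_items: "bij_betw \<iota> (items D) {..<card (items D)}"
  using numbering by (auto simp: numbering_def)

lemma users_nonempty: "users D \<noteq> {}"
  using wf by (simp add: wf_data_def)

lemma intact_tables:
  assumes "intact t"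
  shows "ntab t ''U'' [] = card (users D)" "ntab t ''I'' [] = card (items D)"
    "ntab t ''k'' [] = num_attrs D" "ntab t ''N'' [] = N" "rtab t ''lambda'' [] = lam D"
    "u \<in> users D \<Longrightarrow> i \<in> items D \<Longrightarrow> rtab t ''R'' [\<nu> u, \<iota> i] = rating D u i"
    "u \<in> users D \<Longrightarrow> rtab t ''c0'' [\<nu> u] = init_rep D u"
    "ntab t ''A'' = ntab s0 ''A''"
  using assms input by (auto simp: intact_def inputs_def agree_def input_state_def)

text \<open>Every user is visited for every item and unrated pairs are skipped by a test, which
  gives the product of the two cardinalities. The program and \<open>ranking\<close> use the same
  total division, so their quotients agree even where the sum of reputations vanishes. The 38 is 21
  for the numerator plus 17 for the denominator.\<close>

lemma exec_ranking_com:
  assumes s: "intact s" and c: "\<And>u. u \<in> users D \<Longrightarrow> rtab s c [\<nu> u] = q u"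
    and names: "c \<notin> {''i'', ''u'', ''num'', ''den'', ''r''}"
  shows "exec (ranking_com c) s (card (items D) * (card (users D) * 38 + 26) + 5)
    (\<lambda>t. \<forall>i\<in>items D. rtab t ''r'' [\<iota> i] = ranking D q i)"
  unfolding ranking_com_def
proof (rule exec_For_pointwise[OF bij_items, where K = "card (users D) * 38 + 19"])
  fix i t
  assume i: "i \<in> items D" "ntab t ''i'' [] = \<iota> i"
    and agr: "agree (insert ''i'' (writes (Seq (Seq
     (SumWhere ''u'' ''U'' rated_test ''num''
        (RMul (RGet ''R'' [Get ''u'', Get ''i'']) (RGet c [Get ''u''])))
     (SumWhere ''u'' ''U'' rated_test ''den'' (RGet c [Get ''u''])))
     (RSet ''r'' [Get ''i''] (RDiv (RGet ''num'' []) (RGet ''den'' [])))))) s t"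
  \<comment> \<open>The last conjunct keeps \<open>r\<close> as it was at the start of the round,
    since the enclosing loop demands that a round change just one cell of it.\<close>
  define R where "R t' \<longleftrightarrow> intact t' \<and> ntab t' ''i'' [] = \<iota> i \<and> rtab t' c = rtab s c \<and>
    rtab t' ''r'' = rtab t ''r''" for t'
  have R_agree: "R t''" if "R t'" "agree {''u'', y} t' t''" "y = ''num'' \<or> y = ''den''" for t' t'' y
  proof -
    have "intact t''"
      by (rule intact_agree[OF _ that(2)]) (use that(1,3) in \<open>auto simp: R_def inputs_def\<close>)
    moreover have "c \<notin> {''u'', y}" "''i'' \<notin> {''u'', y}" "''r'' \<notin> {''u'', y}"
      using that(3) names by auto
    ultimately show ?thesis
      using that(1) agree_rtab[OF that(2)] agree_ntab[OF that(2)] unfolding R_def by metis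
  qed
  have "intact t"
    using s agr by (rule intact_agree) (auto simp: inputs_def)
  then have "R t"
    using i(2) names agree_rtab[OF agr, of c] by (simp add: R_def)
  have eval: "bval t' rated_test = (rating D u i > 0)"
    "rval t' (RGet ''R'' [Get ''u'', Get ''i'']) = rating D u i" "rval t' (RGet c [Get ''u'']) = q u"
    if "R t'" "u \<in> users D" "ntab t' ''u'' [] = \<nu> u" for t' u
    using that i(1) intact_tables[of t'] c by (auto simp: R_def rated_test_def)
  have sum1: "exec (SumWhere ''u'' ''U'' rated_test ''num''
        (RMul (RGet ''R'' [Get ''u'', Get ''i'']) (RGet c [Get ''u'']))) t (card (users D) * 21 + 7)
        (\<lambda>t. R t \<and> rtab t ''num'' [] = (\<Sum>u\<in>raters D i. rating D u i * q u))"
    unfolding raters_def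
  proof (rule exec_SumWhere[OF bij_users])
    show "R t'" if "agree {''u'', ''num''} t t'" for t'
      using R_agree[OF \<open>R t\<close> that] by simp
  qed (simp_all add: eval intact_tables[OF \<open>intact t\<close>] rated_test_def[THEN arg_cong[where f = bcost]]
      del: rval.simps(2))
  have sum2: "exec (SumWhere ''u'' ''U'' rated_test ''den'' (RGet c [Get ''u''])) t'
        (card (users D) * 17 + 7) (\<lambda>t. R t \<and> rtab t ''den'' [] = (\<Sum>u\<in>raters D i. q u))"
    if "R t'" for t'
    unfolding raters_def
  proof (rule exec_SumWhere[OF bij_users])
    show "R t''" if "agree {''u'', ''den''} t' t''" for t''
      using R_agree[OF \<open>R t'\<close> that] by simp
    show "ntab t' ''U'' [] = card (users D)"
      using that intact_tables(1) by (simp add: R_def)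
  qed (simp_all add: eval rated_test_def[THEN arg_cong[where f = bcost]] del: rval.simps(2))
  show "exec (Seq (Seq
     (SumWhere ''u'' ''U'' rated_test ''num''
        (RMul (RGet ''R'' [Get ''u'', Get ''i'']) (RGet c [Get ''u''])))
     (SumWhere ''u'' ''U'' rated_test ''den'' (RGet c [Get ''u''])))
     (RSet ''r'' [Get ''i''] (RDiv (RGet ''num'' []) (RGet ''den'' [])))) t (card (users D) * 38 + 19)
     (\<lambda>t'. rtab t' ''r'' = (rtab t ''r'')([\<iota> i] := ranking D q i))"
  proof (rule exec_Seq[OF exec_Seq_keep[OF sum1 sum2 _ order_refl]])
    fix t'
    assume "(R t' \<and> rtab t' ''num'' [] = (\<Sum>u\<in>raters D i. rating D u i * q u)) \<and>
      R t' \<and> rtab t' ''den'' [] = (\<Sum>u\<in>raters D i. q u)"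
    then show "exec (RSet ''r'' [Get ''i''] (RDiv (RGet ''num'' []) (RGet ''den'' []))) t' 5
      (\<lambda>t'. rtab t' ''r'' = (rtab t ''r'')([\<iota> i] := ranking D q i))"
      by (intro exec_RSet) (auto simp: R_def ranking_def)
  next
    fix t' t''
    assume "R t' \<and> rtab t' ''num'' [] = (\<Sum>u\<in>raters D i. rating D u i * q u)"
      "agree (writes (SumWhere ''u'' ''U'' rated_test ''den'' (RGet c [Get ''u'']))) t' t''"
    then show "R t'' \<and> rtab t'' ''num'' [] = (\<Sum>u\<in>raters D i. rating D u i * q u)"
      using R_agree[of t' "''den''" t''] agree_rtab[of "{''u'', ''den''}" t' t'' "''num''"] by simp
  qed simp_all
qed (simp_all add: intact_tables[OF s])

text \<open>The cardinality of \<open>rated D u\<close> arises as a real sum of ones in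
  \<open>den\<close>. The 45 is 29 for the sum of deviations plus 16 for this count.\<close>

lemma exec_reputation_com:
  assumes s: "intact s" and r: "\<And>i. i \<in> items D \<Longrightarrow> rtab s ''r'' [\<iota> i] = r i"
  shows "exec reputation_com s (card (users D) * (card (items D) * 45 + 30) + 5)
    (\<lambda>t. \<forall>u\<in>users D. rtab t ''q'' [\<nu> u] =
       1 - lam D / real (card (rated D u)) * (\<Sum>i\<in>rated D u. \<bar>rating D u i - r i\<bar>))"
  unfolding reputation_com_def
proof (rule exec_For_pointwise[OF bij_users, where K = "card (items D) * 45 + 23"])
  fix u t
  assume u: "u \<in> users D" "ntab t ''u'' [] = \<nu> u"
    and agr: "agree (insert ''u'' (writes (Seq (Seq
     (SumWhere ''i'' ''I'' rated_test ''num'' (RSqrt (RMul deviation deviation)))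
     (SumWhere ''i'' ''I'' rated_test ''den'' (RConst 1)))
     (RSet ''q'' [Get ''u''] (RSub (RConst 1)
        (RMul (RDiv (RGet ''lambda'' []) (RGet ''den'' [])) (RGet ''num'' []))))))) s t"
  define R where "R t' \<longleftrightarrow> intact t' \<and> ntab t' ''u'' [] = \<nu> u \<and> rtab t' ''r'' = rtab s ''r'' \<and>
    rtab t' ''q'' = rtab t ''q''" for t'
  have R_agree: "R t''" if "R t'" "agree {''i'', y} t' t''" "y = ''num'' \<or> y = ''den''" for t' t'' y
  proof -
    have "intact t''"
      by (rule intact_agree[OF _ that(2)]) (use that(1,3) in \<open>auto simp: R_def inputs_def\<close>)
    moreover have "''u'' \<notin> {''i'', y}" "''r'' \<notin> {''i'', y}" "''q'' \<notin> {''i'', y}"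
      using that(3) by auto
    ultimately show ?thesis
      using that(1) agree_rtab[OF that(2)] agree_ntab[OF that(2)] unfolding R_def by metis
  qed
  have "intact t"
    using s agr by (rule intact_agree) (auto simp: inputs_def)
  then have "R t"
    using u(2) agree_rtab[OF agr, of "''r''"] by (simp add: R_def)
  have eval: "bval t' rated_test = (rating D u i > 0)"
    "rval t' (RSqrt (RMul deviation deviation)) = \<bar>rating D u i - r i\<bar>"
    if "R t'" "i \<in> items D" "ntab t' ''i'' [] = \<iota> i" for t' i
    using that u(1) intact_tables[of t'] r by (auto simp: R_def rated_test_def deviation_def)
  have sum1: "exec (SumWhere ''i'' ''I'' rated_test ''num'' (RSqrt (RMul deviation deviation))) t
        (card (items D) * 29 + 7)
        (\<lambda>t. R t \<and> rtab t ''num'' [] = (\<Sum>i\<in>rated D u. \<bar>rating D u i - r i\<bar>))"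
    unfolding rated_def
  proof (rule exec_SumWhere[OF bij_items])
    show "R t'" if "agree {''i'', ''num''} t t'" for t'
      using R_agree[OF \<open>R t\<close> that] by simp
  qed (simp_all add: eval intact_tables[OF \<open>intact t\<close>] rated_test_def[THEN arg_cong[where f = bcost]]
      deviation_def[THEN arg_cong[where f = rcost]] del: rval.simps)
  have sum2: "exec (SumWhere ''i'' ''I'' rated_test ''den'' (RConst 1)) t'
        (card (items D) * 16 + 7) (\<lambda>t. R t \<and> rtab t ''den'' [] = (\<Sum>i\<in>rated D u. 1))"
    if "R t'" for t'
    unfolding rated_def
  proof (rule exec_SumWhere[OF bij_items])
    show "R t''" if "agree {''i'', ''den''} t' t''" for t''
      using R_agree[OF \<open>R t'\<close> that] by simp
    show "ntab t' ''I'' [] = card (items D)"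
      using that intact_tables(2) by (simp add: R_def)
  qed (simp_all add: eval rated_test_def[THEN arg_cong[where f = bcost]])
  show "exec (Seq (Seq
     (SumWhere ''i'' ''I'' rated_test ''num'' (RSqrt (RMul deviation deviation)))
     (SumWhere ''i'' ''I'' rated_test ''den'' (RConst 1)))
     (RSet ''q'' [Get ''u''] (RSub (RConst 1)
        (RMul (RDiv (RGet ''lambda'' []) (RGet ''den'' [])) (RGet ''num'' []))))) t
     (card (items D) * 45 + 23)
     (\<lambda>t'. rtab t' ''q'' = (rtab t ''q'')([\<nu> u] :=
        1 - lam D / real (card (rated D u)) * (\<Sum>i\<in>rated D u. \<bar>rating D u i - r i\<bar>)))"
  proof (rule exec_Seq[OF exec_Seq_keep[OF sum1 sum2 _ order_refl]])
    fix t'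
    assume "(R t' \<and> rtab t' ''num'' [] = (\<Sum>i\<in>rated D u. \<bar>rating D u i - r i\<bar>)) \<and>
      R t' \<and> rtab t' ''den'' [] = (\<Sum>i\<in>rated D u. 1)"
    then show "exec (RSet ''q'' [Get ''u''] (RSub (RConst 1)
        (RMul (RDiv (RGet ''lambda'' []) (RGet ''den'' [])) (RGet ''num'' [])))) t' 9
     (\<lambda>t'. rtab t' ''q'' = (rtab t ''q'')([\<nu> u] :=
        1 - lam D / real (card (rated D u)) * (\<Sum>i\<in>rated D u. \<bar>rating D u i - r i\<bar>)))"
      by (intro exec_RSet) (auto simp: R_def intact_tables)
  next
    fix t' t''
    assume "R t' \<and> rtab t' ''num'' [] = (\<Sum>i\<in>rated D u. \<bar>rating D u i - r i\<bar>)"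
      "agree (writes (SumWhere ''i'' ''I'' rated_test ''den'' (RConst 1))) t' t''"
    then show "R t'' \<and> rtab t'' ''num'' [] = (\<Sum>i\<in>rated D u. \<bar>rating D u i - r i\<bar>)"
      using R_agree[of t' "''den''" t''] agree_rtab[of "{''i'', ''den''}" t' t'' "''num''"] by simp
  qed simp_all
qed (simp_all add: intact_tables[OF s])

text \<open>An iteration costs the ranking and the reputation pass: 83 is 38 + 45, and 17 is the two
  loop overheads of 5 plus the 7 per round of the outer loop.\<close>

lemma exec_base_com:
  assumes s: "intact s"
  shows "exec base_com s
    (N * (83 * (card (users D) * card (items D)) + 30 * card (users D) + 26 * card (items D) + 17) +
      12 * card (users D) + 10)
    (\<lambda>t. \<forall>u\<in>users D. rtab t ''q'' [\<nu> u] = reputation D N u)"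
  unfolding base_com_def
proof (rule exec_Seq)
  let ?init = "For ''u'' ''U'' (RSet ''q'' [Get ''u''] (RGet ''c0'' [Get ''u'']))"
  show "exec ?init s (card (users D) * 12 + 5)
    (\<lambda>t. \<forall>u\<in>users D. rtab t ''q'' [\<nu> u] = reputation D 0 u)"
  proof (rule exec_For_pointwise[OF bij_users, where K = 5])
    fix u t
    assume "u \<in> users D" "ntab t ''u'' [] = \<nu> u"
      and "agree (insert ''u'' (writes (RSet ''q'' [Get ''u''] (RGet ''c0'' [Get ''u''])))) s t"
    then show "exec (RSet ''q'' [Get ''u''] (RGet ''c0'' [Get ''u''])) t 5
        (\<lambda>t'. rtab t' ''q'' = (rtab t ''q'')([\<nu> u] := reputation D 0 u))"
      by (intro exec_RSet) (simp_all add: agree_def intact_tables(7)[OF s])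
  qed (simp_all add: intact_tables(1)[OF s])
  fix t
  assume init: "\<forall>u\<in>users D. rtab t ''q'' [\<nu> u] = reputation D 0 u"
    and agr: "agree (writes ?init) s t"
  have t: "intact t"
    using s agr by (rule intact_agree) (auto simp: inputs_def)
  show "exec (For ''t'' ''N'' (Seq (ranking_com ''q'') reputation_com)) t
    (N * (83 * (card (users D) * card (items D)) + 30 * card (users D) + 26 * card (items D) + 17) + 5)
    (\<lambda>t. \<forall>u\<in>users D. rtab t ''q'' [\<nu> u] = reputation D N u)"
  proof (rule exec_For[where Inv = "\<lambda>m t. \<forall>u\<in>users D. rtab t ''q'' [\<nu> u] = reputation D m u"])
    fix m t'
    assume q: "\<forall>u\<in>users D. rtab t' ''q'' [\<nu> u] = reputation D m u"
      and agr': "agree (insert ''t'' (writes (Seq (ranking_com ''q'') reputation_com))) t t'"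
    have t': "intact t'"
      using t agr' by (rule intact_agree) (auto simp: inputs_def)
    show "exec (Seq (ranking_com ''q'') reputation_com) t'
       (83 * (card (users D) * card (items D)) + 30 * card (users D) + 26 * card (items D) + 10)
      (\<lambda>t'. \<forall>u\<in>users D. rtab (nupd t' ''t'' [] (Suc m)) ''q'' [\<nu> u] = reputation D (Suc m) u)"
    proof (rule exec_Seq)
      show "exec (ranking_com ''q'') t' (card (items D) * (card (users D) * 38 + 26) + 5)
        (\<lambda>t. \<forall>i\<in>items D. rtab t ''r'' [\<iota> i] = ranking D (reputation D m) i)"
        by (rule exec_ranking_com[OF t']) (use q in auto)
      fix t''
      assume r: "\<forall>i\<in>items D. rtab t'' ''r'' [\<iota> i] = ranking D (reputation D m) i"
        and agr'': "agree (writes (ranking_com ''q'')) t' t''"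
      have "intact t''"
        using t' agr'' by (rule intact_agree) (auto simp: inputs_def)
      from exec_reputation_com[OF this, of "ranking D (reputation D m)"] r
      show "exec reputation_com t'' (card (users D) * (card (items D) * 45 + 30) + 5)
        (\<lambda>t'. \<forall>u\<in>users D. rtab (nupd t' ''t'' [] (Suc m)) ''q'' [\<nu> u] = reputation D (Suc m) u)"
        by simp
    qed (simp add: algebra_simps)
  qed (simp_all add: init[simplified] intact_tables(4)[OF t])
qed (simp add: algebra_simps)

section \<open>Group numbers and class tuples\<close>

definition user_group :: "'u \<Rightarrow> nat" where
  "user_group u = group_id (\<lambda>v j. ntab s0 ''A'' [v, j]) (num_attrs D) (\<nu> u)"

text \<open>Each \<open>\<kappa> j\<close> is injective on the classes of attribute
  \<open>j\<close>, so equal table entries mean equal classes; equality for all attributes is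
  equality of the tuples.\<close>

lemma user_group_eq_iff:
  assumes "u \<in> users D" "v \<in> users D"
  shows "user_group v = user_group u \<longleftrightarrow> v \<in> users_in D (tuple_of D u)"
proof -
  have "ntab s0 ''A'' [\<nu> v, j] = ntab s0 ''A'' [\<nu> u, j] \<longleftrightarrow> class_of D j v = class_of D j u"
    if j: "j \<in> {1..num_attrs D}" for j
  proof -
    have "inj_on (\<kappa> j) (attr_classes D j)"
      using numbering j by (auto simp: numbering_def bij_betw_def)
    moreover have "class_of D j v \<in> attr_classes D j" "class_of D j u \<in> attr_classes D j"
      using wf assms j by (auto simp: wf_data_def)
    moreover have "ntab s0 ''A'' [\<nu> w, j] = \<kappa> j (class_of D j w)" if "w \<in> users D" for w
      using input that j by (auto simp: input_state_def)
    ultimately show ?thesis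
      using assms by (simp add: inj_on_eq_iff)
  qed
  then show ?thesis
    using assms by (auto simp: user_group_def group_id_eq_iff users_in_def tuple_of_def)
qed

text \<open>A member of \<open>users_in D l\<close> determines \<open>l\<close>, as its classes fix
  the values on the attributes and the extensional product fixes all others. The product of the
  class sets, which may be exponentially large, thus reduces to an image of the users.\<close>

lemma occurring_tuples_eq: "occurring_tuples D = tuple_of D ` users D"
proof (intro set_eqI iffI)
  fix l assume "l \<in> occurring_tuples D"
  then obtain u where l: "l \<in> Pi\<^sub>E {1..num_attrs D} (attr_classes D)" and u: "u \<in> users_in D l"
    by (auto simp: occurring_tuples_def)
  from u have "u \<in> users D"
    by (simp add: users_in_def)
  with users_in_iff_tuple_of[OF l this] u show "l \<in> tuple_of D ` users D"
    by auto
next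
  fix l assume "l \<in> tuple_of D ` users D"
  then obtain u where u: "u \<in> users D" "l = tuple_of D u"
    by blast
  have "l \<in> Pi\<^sub>E {1..num_attrs D} (attr_classes D)"
    using wf u by (auto simp: tuple_of_def wf_data_def)
  with users_in_iff_tuple_of[OF this u(1)] u show "l \<in> occurring_tuples D"
    by (auto simp: occurring_tuples_def)
qed

text \<open>Translates minima over occurring tuples into minima over users, with repetitions, in
  exactly the form that the mitigation program delivers.\<close>

lemma mitigated_reputation_eq:
  fixes q :: "'u \<Rightarrow> real"
  defines "q \<equiv> reputation D N" and "B \<equiv> \<lambda>u. {v \<in> users D. user_group v = user_group u}"
  assumes u: "u \<in> users D"
  shows "mitigated_reputation D N u = Min ((\<lambda>u. avg q (B u)) ` users D) +
     (q u - avg q (B u)) * (Min ((\<lambda>u. std q (B u)) ` users D) / std q (B u))"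
proof -
  have B: "users_in D (tuple_of D v) = B v" if "v \<in> users D" for v
    using user_group_eq_iff[OF that] by (auto simp: B_def) (auto simp: users_in_def)
  have "group_avg D N ` occurring_tuples D = (\<lambda>u. avg q (B u)) ` users D"
    "group_std D N ` occurring_tuples D = (\<lambda>u. std q (B u)) ` users D"
    by (auto simp: occurring_tuples_eq image_image group_avg_def group_std_def B q_def)
  then show ?thesis
    by (simp add: mitigated_reputation_def Let_def group_avg_def group_std_def B u q_def)
qed

section \<open>The whole program and its cost\<close>

lemma exec_mitigated_ranking_com:
  "exec mitigated_ranking_com s0
    (N * (83 * (card (users D) * card (items D)) + 30 * card (users D) + 26 * card (items D) + 17) +
      12 * card (users D) + 10 +
      (num_attrs D * (card (users D) * 41 + 12) + 5) +
      (card (users D) * 138 + 46) +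
      (card (items D) * (card (users D) * 38 + 26) + 5))
    (output_state D N \<nu> \<iota>)"
  unfolding mitigated_ranking_com_def
proof (rule exec_Seq)
  let ?U = "card (users D)"
  let ?b = "N * (83 * (?U * card (items D)) + 30 * ?U + 26 * card (items D) + 17) + 12 * ?U + 10"
  let ?g = "num_attrs D * (?U * 41 + 12) + 5"
  define q where "q = reputation D N"
  \<comment> \<open>The last conjunct holds because neither the iterations nor the grouping write
    \<open>S\<close>, \<open>C\<close> or \<open>V\<close>; the sums by group rely on these tables
    being zero.\<close>
  define R where "R t \<longleftrightarrow> intact t \<and> (\<forall>u\<in>users D. rtab t ''q'' [\<nu> u] = q u) \<and>
    (\<forall>u\<in>users D. ntab t ''g'' [\<nu> u] = user_group u) \<and>
    (\<forall>y\<in>{''S'', ''C'', ''V''}. \<forall>is. rtab t y is = 0)" for t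
  have s0: "intact s0"
    by (simp add: intact_def agree_refl)
  have groups: "exec (Seq base_com group_com) s0 (?b + ?g) R"
  proof (rule exec_Seq[OF exec_base_com[OF s0]])
    fix t
    assume q: "\<forall>u\<in>users D. rtab t ''q'' [\<nu> u] = reputation D N u"
      and agr: "agree (writes base_com) s0 t"
    have t: "intact t"
      using s0 agr by (rule intact_agree) (auto simp: inputs_def)
    have "exec group_com t ?g (\<lambda>t. \<forall>u<?U. ntab t ''g'' [u] =
      group_id (\<lambda>v j. ntab s0 ''A'' [v, j]) (num_attrs D) u)"
      by (rule exec_group_com)
        (use agr input in \<open>simp_all add: intact_tables[OF t] agree_def input_state_def\<close>)
    then show "exec group_com t ?g R"
    proof (rule exec_conseq)
      fix t'
      assume g: "\<forall>u<?U. ntab t' ''g'' [u] =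
          group_id (\<lambda>v j. ntab s0 ''A'' [v, j]) (num_attrs D) u"
        and agr': "agree (writes group_com) t t'"
      have "intact t'"
        using t agr' by (rule intact_agree) (auto simp: inputs_def)
      moreover have "\<nu> u < ?U" if "u \<in> users D" for u
        using bij_users that by (auto simp: bij_betw_def)
      ultimately show "R t'"
        using g q agr agr' input
        by (auto simp: R_def q_def user_group_def agree_def input_state_def)
    qed simp
  qed simp
  let ?B = "\<lambda>u. {v \<in> users D. user_group v = user_group u}"
  show "exec (Seq (Seq base_com group_com) mitigate_com) s0 (?b + ?g + (?U * 138 + 46))
    (\<lambda>t. intact t \<and> (\<forall>u\<in>users D. rtab t ''c'' [\<nu> u] = mitigated_reputation D N u))"
    using groups
  proof (rule exec_Seq)
    fix t assume t: "R t"
    have "exec mitigate_com t (?U * 138 + 46) (\<lambda>t. \<forall>u\<in>users D. rtab t ''c'' [\<nu> u] =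
       Min ((\<lambda>u. avg q (?B u)) ` users D) +
       (q u - avg q (?B u)) * (Min ((\<lambda>u. std q (?B u)) ` users D) / std q (?B u)))"
      by (rule exec_mitigate_com[OF bij_users users_nonempty])
        (use t in \<open>auto simp: R_def intact_tables(1)\<close>)
    then show "exec mitigate_com t (?U * 138 + 46)
      (\<lambda>t. intact t \<and> (\<forall>u\<in>users D. rtab t ''c'' [\<nu> u] = mitigated_reputation D N u))"
    proof (rule exec_conseq, intro conjI)
      fix t'
      assume "agree (writes mitigate_com) t t'"
      then show "intact t'"
        by (rule intact_agree[rotated]) (use t in \<open>auto simp: R_def inputs_def\<close>)
    qed (simp_all add: mitigated_reputation_eq q_def)
  qed simp
  fix t
  assume t: "intact t \<and> (\<forall>u\<in>users D. rtab t ''c'' [\<nu> u] = mitigated_reputation D N u)"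
  then have "exec (ranking_com ''c'') t (card (items D) * (?U * 38 + 26) + 5)
    (\<lambda>t. \<forall>i\<in>items D. rtab t ''r'' [\<iota> i] = ranking D (mitigated_reputation D N) i)"
    by (intro exec_ranking_com) auto
  then show "exec (ranking_com ''c'') t (card (items D) * (?U * 38 + 26) + 5) (output_state D N \<nu> \<iota>)"
    by (rule exec_conseq) (use t in \<open>auto simp: output_state_def mitigated_ranking_def agree_def\<close>)
qed simp

text \<open>\<open>N\<close> and both cardinalities are at least 1, so each monomial without
  \<open>k\<close> is at most \<open>N * U * I\<close>, and \<open>k\<close> is at most
  \<open>k * U\<close>. The coefficients then sum to 436 and 53; 500 is a round number above
  both.\<close>

lemma cost_bound:
  "N * (83 * (card (users D) * card (items D)) + 30 * card (users D) + 26 * card (items D) + 17) +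
      12 * card (users D) + 10 +
      (num_attrs D * (card (users D) * 41 + 12) + 5) +
      (card (users D) * 138 + 46) +
      (card (items D) * (card (users D) * 38 + 26) + 5)
   \<le> 500 * (N * card (users D) * card (items D) + num_attrs D * card (users D))"
proof -
  define U I k where "U = card (users D)" and "I = card (items D)" and "k = num_attrs D"
  have U: "1 \<le> U" and I: "1 \<le> I"
    using wf by (auto simp: U_def I_def wf_data_def Suc_le_eq card_gt_0_iff)
  have "N * (83 * (U * I) + 30 * U + 26 * I + 17) + 12 * U + 10 +
      (k * (U * 41 + 12) + 5) + (U * 138 + 46) + (I * (U * 38 + 26) + 5) =
    83 * (N * U * I) + 30 * (N * U) + 26 * (N * I) + 17 * N + 150 * U + 66 +
      41 * (k * U) + 12 * k + 38 * (U * I) + 26 * I"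
    by (simp add: algebra_simps)
  also have "\<dots> \<le> 500 * (N * U * I) + 500 * (k * U)"
  proof -
    have "N * U \<le> N * U * I" "N * I \<le> N * U * I" "N \<le> N * U * I" "U \<le> N * U * I"
      "1 \<le> N * U * I" "I \<le> N * U * I" "U * I \<le> N * U * I" "k \<le> k * U"
      using N U I by simp_all
    then show ?thesis
      by linarith
  qed
  also have "\<dots> = 500 * (N * U * I + k * U)"
    by simp
  finally show ?thesis
    unfolding U_def I_def k_def .
qed

end

text \<open>Program and constant are chosen before all data, so the number of attributes is itself
  an input and one piece of syntax has to serve every \<open>k\<close>.\<close>

theorem proposition2:
  "\<exists>(P :: com) (C :: nat). \<forall>(D :: ('u, 'i, 'a) rating_data) (N :: nat) \<nu> \<iota> \<kappa> s.
     wf_data D \<longrightarrow> N > 0 \<longrightarrow> (\<forall>l\<in>occurring_tuples D. group_std D N l > 0) \<longrightarrow>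
     numbering D \<nu> \<iota> \<kappa> \<longrightarrow> input_state D N \<nu> \<iota> \<kappa> s \<longrightarrow>
     (\<exists>n t. run P s n t \<and> output_state D N \<nu> \<iota> t \<and>
        n \<le> C * (N * card (users D) * card (items D) + num_attrs D * card (users D)))"
proof (rule exI[of _ mitigated_ranking_com], rule exI[of _ 500], intro allI impI)
  fix D :: "('u, 'i, 'a) rating_data" and N :: nat and \<nu> \<iota> \<kappa> s
  assume "wf_data D" "N > 0" "numbering D \<nu> \<iota> \<kappa>" "input_state D N \<nu> \<iota> \<kappa> s"
  then interpret ranking_input D N \<nu> \<iota> \<kappa> s
    by unfold_locales
  show "\<exists>n t. run mitigated_ranking_com s n t \<and> output_state D N \<nu> \<iota> t \<and>
      n \<le> 500 * (N * card (users D) * card (items D) + num_attrs D * card (users D))"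
    using exec_mitigated_ranking_com cost_bound unfolding exec_def by (meson le_trans)
qed

end
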